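(* Let $\alpha,\theta>0$ and consider the symmetric two-player optimal stopping game described in the context: $p=\frac12$ (so that the underlying process $X$ is a standard Brownian bridge), $\mathcal G_1(z)=z-\alpha$, $\mathcal L_1(z)=\theta z$, $\mathcal G_2(z)=-z-\alpha$, $\mathcal L_2(z)=-\theta z$. Let $\psi(z)=e^{z^2/2}\int_0^ze^{-u^2/2}du$. Then: (1) The game admits at most three symmetric threshold-type Nash equilibria. (2) If $\theta\ge 1+\max\left\{2\alpha\left[\alpha+(\alpha^2+1)\psi(\alpha)\right],\ \frac1\alpha(4+\alpha^2)\psi\!\left(\frac\alpha2\right)\right\}$, then there are no symmetric threshold-type Nash equilibria. (3) If $\theta\le1$, then there is a unique symmetric threshold-type Nash equilibrium. (4) There exist values of $\alpha,\theta>0$ for which there is more than one symmetric threshold-type Nash equilibrium.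
   Context: $X=(X_t)_{0\le t\le1}$ is a standard Brownian bridge from $0$ to $0$ on $[0,1]$, on a filtered probability space satisfying the usual conditions. Player 1 chooses a stopping time $\tau$ and Player 2 a stopping time $\sigma$, with values in $[0,1]$. The expected payoffs are $$R_1(\tau,\sigma)=\mathbb E[\mathbb G_1(\tau,X_\tau)\mathbb I_{\{\tau\le\sigma\}}+\mathbb L_1(\sigma,X_\sigma)\mathbb I_{\{\sigma<\tau\}}],$$ $$R_2(\tau,\sigma)=\mathbb E[\mathbb G_2(\sigma,X_\sigma)\mathbb I_{\{\sigma\le\tau\}}+\mathbb L_2(\tau,X_\tau)\mathbb I_{\{\tau<\sigma\}}],$$ where $\mathbb G_i(t,x)=\sqrt{1-t}\,\mathcal G_i(x/\sqrt{1-t})$, $\mathbb L_i(t,x)=\sqrt{1-t}\,\mathcal L_i(x/\sqrt{1-t})$ for $t<1$ and $\mathbb G_i(1,0)=\mathbb L_i(1,0)=0$; that is, $\mathbb G_1(t,x)=x-\alpha\sqrt{1-t}$ for $x\ge0$, $\mathbb G_2(t,x)=-x-\alpha\sqrt{1-t}$ for $x\le0$, $\mathbb L_1(t,x)=\theta x$, $\mathbb L_2(t,x)=-\theta x$. Player 1 may only stop when $X\ge0$ and Player 2 only when $X\le0$ ($\mathbb G_1=-\infty$ for $x<0$, $\mathbb G_2=-\infty$ for $x>0$). $\mathcal T^{\mathbb{SQ}}$ is the class of square-root threshold strategies: for Player 1, $\tau^b=\inf\{t\ge0:X_t\ge b\sqrt{1-t}\}$ with $b\in[0,\infty)$; for Player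 2, $\sigma^d=\inf\{t\ge0:X_t\le-d\sqrt{1-t}\}$ with $d\in[0,\infty)$. A symmetric (threshold-type) Nash equilibrium is a pair $(\tau^*,\sigma^* )=(\tau^{b^*},\sigma^{d^*})$ with $b^*=d^*\in[0,\infty)$ such that $$R_1(\tau^*,\sigma^* )=\sup_{\tau\in\mathcal T^{\mathbb{SQ}}}R_1(\tau,\sigma^* ),\qquad R_2(\tau^*,\sigma^* )=\sup_{\sigma\in\mathcal T^{\mathbb{SQ}}}R_2(\tau^*,\sigma).$$ Equilibria are counted by their common threshold value $b^*=d^*$. *)

theory Defs
  imports "HOL-Probability.Probability"
begin

section \<open>Brownian bridge on a filtered probability space\<close>

text \<open>Only the time set \<open>[0,1]\<close> matters. Since the library's \<open>filtration\<close> is indexed by a whole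
  linearly ordered type, \<open>F\<close> is a family over all reals; a filtration on \<open>[0,1]\<close> can always be
  extended constantly outside \<open>[0,1]\<close>.\<close>

locale usual_filtration = prob_space M + complete_measure M + filtration "space M" F
  for M :: "'a measure" and F :: "real \<Rightarrow> 'a measure" +
  assumes subalgebra_F: "\<And>t. t \<in> {0..1} \<Longrightarrow> subalgebra M (F t)"
    and null_sets_F: "null_sets M \<subseteq> sets (F 0)"
    and right_continuous_F: "\<And>t. t \<in> {0..<1} \<Longrightarrow> sets (F t) = (\<Inter>s\<in>{t<..1}. sets (F s))"

definition gaussian_law :: "real \<Rightarrow> real \<Rightarrow> real measure" where
  "gaussian_law m v = (if v = 0 then return borel m else density lborel (normal_density m (sqrt v)))"

text \<open>A standard Brownian bridge from 0 to 0 relative to \<open>F\<close>: a continuous, adapted, centred Gaussian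
  process with covariance \<open>min s t - s * t\<close>. Being a bridge relative to \<open>F\<close>, and not merely
  relative to its own filtration, means that the part of \<open>X t\<close> not explained by \<open>X s\<close> is independent
  of \<open>F s\<close> (the counterpart of the independence of increments of an \<open>F\<close>-Brownian motion).\<close>

locale brownian_bridge = usual_filtration M F
  for M :: "'a measure" and F :: "real \<Rightarrow> 'a measure" +
  fixes X :: "real \<Rightarrow> 'a \<Rightarrow> real"
  assumes adapted: "\<And>t. t \<in> {0..1} \<Longrightarrow> X t \<in> borel_measurable (F t)"
    and continuous_paths: "\<And>\<omega>. \<omega> \<in> space M \<Longrightarrow> continuous_on {0..1} (\<lambda>t. X t \<omega>)"
    and starts_at_0: "\<And>\<omega>. \<omega> \<in> space M \<Longrightarrow> X 0 \<omega> = 0"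
    and ends_at_0: "\<And>\<omega>. \<omega> \<in> space M \<Longrightarrow> X 1 \<omega> = 0"
    and gaussian: "\<And>T c. finite T \<Longrightarrow> T \<subseteq> {0..1} \<Longrightarrow>
      distr M borel (\<lambda>\<omega>. \<Sum>t\<in>T. c t * X t \<omega>) =
        gaussian_law 0 (\<Sum>s\<in>T. \<Sum>t\<in>T. c s * c t * (min s t - s * t))"
    and indep_past: "\<And>s t. 0 \<le> s \<Longrightarrow> s \<le> t \<Longrightarrow> t \<le> 1 \<Longrightarrow> s < 1 \<Longrightarrow>
      indep_set (sets (F s))
        (sets (vimage_algebra (space M) (\<lambda>\<omega>. X t \<omega> - (1 - t) / (1 - s) * X s \<omega>) borel))"

section \<open>The stopping game\<close>

text \<open>Payoffs take the value \<open>-\<infinity>\<close> where stopping is forbidden, so expectations are taken in the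
  extended reals, as expectation of the positive part minus expectation of the negative part
  (\<open>e2ennreal\<close> sends negative numbers to 0).\<close>

definition ext_expectation :: "'a measure \<Rightarrow> ('a \<Rightarrow> ereal) \<Rightarrow> ereal" where
  "ext_expectation M Y =
     enn2ereal (\<integral>\<^sup>+\<omega>. e2ennreal (Y \<omega>) \<partial>M) - enn2ereal (\<integral>\<^sup>+\<omega>. e2ennreal (- Y \<omega>) \<partial>M)"

text \<open>At time 1 the process is at 0, where the payoff is set to 0.\<close>

definition scaled_payoff :: "(real \<Rightarrow> ereal) \<Rightarrow> real \<Rightarrow> real \<Rightarrow> ereal" where
  "scaled_payoff f t x = (if t < 1 then ereal (sqrt (1 - t)) * f (x / sqrt (1 - t)) else 0)"

definition profile_G1 :: "real \<Rightarrow> real \<Rightarrow> ereal" where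
  "profile_G1 \<alpha> z = (if 0 \<le> z then ereal (z - \<alpha>) else - \<infinity>)"

definition profile_G2 :: "real \<Rightarrow> real \<Rightarrow> ereal" where
  "profile_G2 \<alpha> z = (if z \<le> 0 then ereal (- z - \<alpha>) else - \<infinity>)"

definition profile_L1 :: "real \<Rightarrow> real \<Rightarrow> ereal" where
  "profile_L1 \<theta> z = ereal (\<theta> * z)"

definition profile_L2 :: "real \<Rightarrow> real \<Rightarrow> ereal" where
  "profile_L2 \<theta> z = ereal (- \<theta> * z)"

definition R1 :: "'a measure \<Rightarrow> (real \<Rightarrow> 'a \<Rightarrow> real) \<Rightarrow> real \<Rightarrow> real \<Rightarrow>
    ('a \<Rightarrow> real) \<Rightarrow> ('a \<Rightarrow> real) \<Rightarrow> ereal" where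
  "R1 M X \<alpha> \<theta> \<tau> \<sigma> = ext_expectation M (\<lambda>\<omega>.
     if \<tau> \<omega> \<le> \<sigma> \<omega> then scaled_payoff (profile_G1 \<alpha>) (\<tau> \<omega>) (X (\<tau> \<omega>) \<omega>)
     else scaled_payoff (profile_L1 \<theta>) (\<sigma> \<omega>) (X (\<sigma> \<omega>) \<omega>))"

definition R2 :: "'a measure \<Rightarrow> (real \<Rightarrow> 'a \<Rightarrow> real) \<Rightarrow> real \<Rightarrow> real \<Rightarrow>
    ('a \<Rightarrow> real) \<Rightarrow> ('a \<Rightarrow> real) \<Rightarrow> ereal" where
  "R2 M X \<alpha> \<theta> \<tau> \<sigma> = ext_expectation M (\<lambda>\<omega>.
     if \<sigma> \<omega> \<le> \<tau> \<omega> then scaled_payoff (profile_G2 \<alpha>) (\<sigma> \<omega>) (X (\<sigma> \<omega>) \<omega>)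
     else scaled_payoff (profile_L2 \<theta>) (\<tau> \<omega>) (X (\<tau> \<omega>) \<omega>))"

text \<open>The infima are over nonempty sets: a bridge is at 0 at time 1, so \<open>t = 1\<close> always qualifies.\<close>

definition tau_sq :: "(real \<Rightarrow> 'a \<Rightarrow> real) \<Rightarrow> real \<Rightarrow> 'a \<Rightarrow> real" where
  "tau_sq X b \<omega> = Inf {t \<in> {0..1}. X t \<omega> \<ge> b * sqrt (1 - t)}"

definition sigma_sq :: "(real \<Rightarrow> 'a \<Rightarrow> real) \<Rightarrow> real \<Rightarrow> 'a \<Rightarrow> real" where
  "sigma_sq X d \<omega> = Inf {t \<in> {0..1}. X t \<omega> \<le> - d * sqrt (1 - t)}"

definition strategies1 :: "(real \<Rightarrow> 'a \<Rightarrow> real) \<Rightarrow> ('a \<Rightarrow> real) set" where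
  "strategies1 X = {tau_sq X b | b. 0 \<le> b}"

definition strategies2 :: "(real \<Rightarrow> 'a \<Rightarrow> real) \<Rightarrow> ('a \<Rightarrow> real) set" where
  "strategies2 X = {sigma_sq X d | d. 0 \<le> d}"

definition nash_equilibrium :: "'a measure \<Rightarrow> (real \<Rightarrow> 'a \<Rightarrow> real) \<Rightarrow> real \<Rightarrow> real \<Rightarrow>
    ('a \<Rightarrow> real) \<Rightarrow> ('a \<Rightarrow> real) \<Rightarrow> bool" where
  "nash_equilibrium M X \<alpha> \<theta> \<tau>\<^sub>0 \<sigma>\<^sub>0 \<longleftrightarrow>
     \<tau>\<^sub>0 \<in> strategies1 X \<and> \<sigma>\<^sub>0 \<in> strategies2 X \<and>
     R1 M X \<alpha> \<theta> \<tau>\<^sub>0 \<sigma>\<^sub>0 = (SUP \<tau>\<in>strategies1 X. R1 M X \<alpha> \<theta> \<tau> \<sigma>\<^sub>0) \<and>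
     R2 M X \<alpha> \<theta> \<tau>\<^sub>0 \<sigma>\<^sub>0 = (SUP \<sigma>\<in>strategies2 X. R2 M X \<alpha> \<theta> \<tau>\<^sub>0 \<sigma>)"

text \<open>Symmetric threshold-type equilibria, represented by their common threshold.\<close>

definition symmetric_equilibria ::
    "'a measure \<Rightarrow> (real \<Rightarrow> 'a \<Rightarrow> real) \<Rightarrow> real \<Rightarrow> real \<Rightarrow> real set" where
  "symmetric_equilibria M X \<alpha> \<theta> = {b. 0 \<le> b \<and> nash_equilibrium M X \<alpha> \<theta> (tau_sq X b) (sigma_sq X b)}"

definition psi :: "real \<Rightarrow> real" where
  "psi z = exp (z\<^sup>2 / 2) * (LBINT u=0..z. exp (- u\<^sup>2 / 2))"

end

(*
  Integrating the exponential martingales of the Brownian motion X_t / (1 - t) over a half line of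
  parameters gives the martingales sqrt (1 - t) * f (X_t / sqrt (1 - t)) with
  f y = exp (y^2 / 2) * (c + Phi y) and its reflection, where Phi y is the integral of
  exp (- u^2 / 2) over [0, y] and c = Phi \<infinity>. So only the exponential martingales have to be
  stopped, and the two resulting linear equations determine E[sqrt (1 - tau); tau < sigma] for
  tau = tau^b and sigma = sigma^d as exp (- b^2 / 2) * Phi d / (Phi b + Phi d).

  The best-response problem then becomes one-dimensional: d is an equilibrium threshold iff
  d > alpha / 2, Q d = 2 (1 + alpha d - d^2) psi d + alpha - (1 + theta) d = 0, and the payoff at
  (d, d) is at least -alpha, the payoff of stopping immediately. Since Q' = 2 (alpha - d) psi'' + 1 - theta
  and Q'' = 2 psi''' (alpha - d - psi'' / psi''') with d + psi'' / psi''' increasing, Q has at most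
  three zeros; the remaining claims follow from the sign of Q' and explicit values of Q.
*)
theory Submission
  imports Defs
begin

section \<open>Derivatives of psi and the first-order condition\<close>

text \<open>The closed form of the hitting values makes the payoff against \<open>d > 0\<close> a
  positive multiple of \<open>response\<close> plus a constant, so only the shape of
  \<open>response\<close> in \<open>b\<close> matters. The function carrying the sign of its
  derivative rises up to \<alpha> / 2 and falls afterwards, whatever \<open>d\<close> is. A critical
  point is therefore a maximum only beyond \<alpha> / 2, and the one remaining rival on its left is
  the end point 0: this is where the comparison with immediate stopping comes from. For
  \<open>d = 0\<close> the opponent stops at time 0 and that pair is treated directly. The
  probabilistic obstacle is time 1. The clock t / (1 - t) of the Brownian motion explodes there, so
  the exponential martingales are stopped at times capped by some T < 1, where their second moments
  stay bounded. The cap is removed only after integrating over the parameter, when the factor sqrt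
  (1 - t) suppresses the paths that reach no boundary before time 1. Reflection of the bridge
  transfers everything to the second player.\<close>

definition gauss_int :: "real \<Rightarrow> real" where
  "gauss_int z = (LBINT u=0..z. exp (- u\<^sup>2 / 2))"

lemma psi_eq: "psi z = exp (z\<^sup>2 / 2) * gauss_int z"
  by (simp add: psi_def gauss_int_def)

lemma gauss_int_0 [simp]: "gauss_int 0 = 0"
  by (simp add: gauss_int_def flip: zero_ereal_def)

lemma has_real_derivative_gauss_int [derivative_intros]:
  "(gauss_int has_real_derivative exp (- x\<^sup>2 / 2)) (at x)"
proof -
  \<comment> \<open>The interval contains the base point 0 and has \<open>x\<close> in its interior,
    so the derivative within it is the two-sided one.\<close>
  have "((\<lambda>u. LBINT y=0..u. exp (- y\<^sup>2 / 2)) has_vector_derivative exp (- x\<^sup>2 / 2))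
      (at x within {-\<bar>x\<bar>-1..\<bar>x\<bar>+1})"
    using interval_integral_FTC2[of "-\<bar>x\<bar>-1" 0 "\<bar>x\<bar>+1" "\<lambda>y. exp (- y\<^sup>2 / 2)" x]
    by (force simp: zero_ereal_def intro!: continuous_intros)
  moreover have "at x within {-\<bar>x\<bar>-1..\<bar>x\<bar>+1} = at x"
    by (rule at_within_interior) (auto simp: interior_atLeastAtMost_real)
  ultimately show ?thesis
    by (simp add: has_real_derivative_iff_has_vector_derivative gauss_int_def[abs_def])
qed

lemma gauss_int_strict_mono: "x < y \<Longrightarrow> gauss_int x < gauss_int y"
  by (rule DERIV_pos_imp_increasing[where f=gauss_int])
     (auto intro!: exI has_real_derivative_gauss_int)

lemma gauss_int_mono: "x \<le> y \<Longrightarrow> gauss_int x \<le> gauss_int y"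
  using gauss_int_strict_mono[of x y] by (cases "x = y") auto

lemma gauss_int_pos: "0 < x \<Longrightarrow> 0 < gauss_int x"
  using gauss_int_strict_mono[of 0 x] by simp

lemma has_real_derivative_psi: "(psi has_real_derivative x * psi x + 1) (at x)"
  unfolding psi_eq[abs_def]
  by (auto intro!: derivative_eq_intros simp: algebra_simps power2_eq_square simp flip: exp_add)

lemma psi_0 [simp]: "psi 0 = 0"
  by (simp add: psi_eq)

lemma psi_pos: "0 < x \<Longrightarrow> 0 < psi x"
  by (simp add: psi_eq gauss_int_pos)

lemma psi_nonneg: "0 \<le> x \<Longrightarrow> 0 \<le> psi x"
  using psi_pos[of x] by (cases "x = 0") auto

text \<open>The successive derivatives of \<open>psi\<close>. From p' = x p + 1 the n-th derivative
  p_n satisfies p_(n+1) = x p_n + n p_(n-1), so all signs on the half line follow recursively from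
  that of \<open>psi\<close>.\<close>

definition psi1 :: "real \<Rightarrow> real" where "psi1 x = x * psi x + 1"
definition psi2 :: "real \<Rightarrow> real" where "psi2 x = x * psi1 x + psi x"
definition psi3 :: "real \<Rightarrow> real" where "psi3 x = x * psi2 x + 2 * psi1 x"

lemma DERIV_psi: "(psi has_real_derivative psi1 x) (at x)"
  using has_real_derivative_psi by (simp add: psi1_def)
lemma DERIV_psi1: "(psi1 has_real_derivative psi2 x) (at x)"
  unfolding psi1_def[abs_def] psi2_def
  by (auto intro!: derivative_eq_intros DERIV_psi simp: psi1_def)
lemma DERIV_psi2: "(psi2 has_real_derivative psi3 x) (at x)"
  unfolding psi2_def[abs_def] psi3_def
  by (auto intro!: derivative_eq_intros DERIV_psi DERIV_psi1 simp: psi2_def)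
lemma DERIV_psi3: "(psi3 has_real_derivative x * psi3 x + 3 * psi2 x) (at x)"
  unfolding psi3_def[abs_def]
  by (auto intro!: derivative_eq_intros DERIV_psi1 DERIV_psi2 simp: psi3_def)

lemma psi1_ge_1: "0 \<le> x \<Longrightarrow> 1 \<le> psi1 x"
  by (simp add: psi1_def psi_nonneg)

lemma psi2_pos: "0 < x \<Longrightarrow> 0 < psi2 x"
  using psi1_ge_1[of x] psi_pos[of x] by (simp add: psi2_def add_pos_pos)

lemma psi2_nonneg: "0 \<le> x \<Longrightarrow> 0 \<le> psi2 x"
  using psi1_ge_1[of x] psi_nonneg[of x] by (simp add: psi2_def)

lemma psi3_pos: "0 \<le> x \<Longrightarrow> 0 < psi3 x"
  using psi1_ge_1[of x] psi2_nonneg[of x] by (simp add: psi3_def add_nonneg_pos)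

lemma psi2_mono: assumes "0 \<le> x" "x \<le> y" shows "psi2 x \<le> psi2 y"
proof (rule DERIV_nonneg_imp_nondecreasing[OF assms(2)])
  fix z assume "x \<le> z"
  with assms(1) have "0 \<le> psi3 z" by (simp add: less_imp_le psi3_pos)
  then show "\<exists>D. (psi2 has_real_derivative D) (at z) \<and> 0 \<le> D" using DERIV_psi2 by blast
qed

text \<open>The difference of the two sides vanishes at 0 and has derivative
  \<open>x * psi2 x\<close>. Combined with \<open>psi2 x = x * psi1 x + psi x\<close> this yields
  \<open>psi2 x \<le> 2 * x * psi1 x\<close>, the input of the next bound.\<close>

lemma psi_le: assumes "0 \<le> x" shows "psi x \<le> x * psi1 x"
proof -
  have "0 * psi1 0 - psi 0 \<le> x * psi1 x - psi x"
  proof (rule DERIV_nonneg_imp_nondecreasing[OF assms, where f="\<lambda>x. x * psi1 x - psi x"])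
    fix z :: real assume "0 \<le> z"
    have "((\<lambda>x. x * psi1 x - psi x) has_real_derivative z * psi2 z) (at z)"
      by (auto intro!: derivative_eq_intros DERIV_psi DERIV_psi1)
    with psi2_nonneg[OF \<open>0 \<le> z\<close>] \<open>0 \<le> z\<close>
    show "\<exists>D. ((\<lambda>x. x * psi1 x - psi x) has_real_derivative D) (at z) \<and> 0 \<le> D"
      by (intro exI[of _ "z * psi2 z"]) simp
  qed
  then show ?thesis by simp
qed

text \<open>Since \<open>x * psi3 x + 3 * psi2 x\<close> is the derivative of \<open>psi3\<close>,
  this says that \<open>psi2 / psi3\<close> has derivative above -1. In terms of \<open>p\<close>
  and \<open>q\<close> the only negative term is \<open>- 3 * q^2\<close>, and
  \<open>q \<le> 2 * x * p\<close> lets \<open>6 * x * p * q\<close> absorb it.\<close>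

lemma psi2_psi3_bound:
  assumes "0 \<le> x"
  shows "psi2 x * (x * psi3 x + 3 * psi2 x) < 2 * (psi3 x)\<^sup>2"
proof -
  define p where "p = psi1 x"
  define q where "q = psi2 x"
  have p: "1 \<le> p" using psi1_ge_1 assms by (simp add: p_def)
  have q: "x * p \<le> q" "q \<le> 2 * x * p"
    using psi_nonneg[OF assms] psi_le[OF assms] by (auto simp: p_def q_def psi2_def)
  have q0: "0 \<le> q" using assms psi2_nonneg q_def by simp
  have eq: "2 * (psi3 x)\<^sup>2 - psi2 x * (x * psi3 x + 3 * psi2 x) = x\<^sup>2*q\<^sup>2 + 6*x*p*q + 8*p\<^sup>2 - 3*q\<^sup>2"
    by (simp add: psi3_def p_def q_def algebra_simps power2_eq_square)
  have "0 < x\<^sup>2*q\<^sup>2 + 6*x*p*q + 8*p\<^sup>2 - 3*q\<^sup>2"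
  proof -
    have "3 * q\<^sup>2 \<le> 6 * x * p * q"
      using mult_right_mono[OF q(2) q0] by (simp add: power2_eq_square algebra_simps)
    moreover have "0 < 8 * p\<^sup>2" using p by simp
    moreover have "0 \<le> x\<^sup>2 * q\<^sup>2" by simp
    ultimately show ?thesis by linarith
  qed
  with eq show ?thesis by linarith
qed

text \<open>The first-order condition for a symmetric equilibrium, cf. \<open>slope_diag\<close> below.\<close>

definition foc :: "real \<Rightarrow> real \<Rightarrow> real \<Rightarrow> real" where
  "foc \<alpha> \<theta> d = 2 * (1 + \<alpha> * d - d\<^sup>2) * psi d + \<alpha> - (1 + \<theta>) * d"

lemma DERIV_foc: "(foc \<alpha> \<theta> has_real_derivative 2 * (\<alpha> - d) * psi2 d + 1 - \<theta>) (at d)"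
  unfolding foc_def[abs_def]
  by (auto intro!: derivative_eq_intros DERIV_psi simp: psi2_def psi1_def algebra_simps power2_eq_square)

lemma DERIV_foc': "((\<lambda>d. 2 * (\<alpha> - d) * psi2 d + 1 - \<theta>) has_real_derivative
    2 * (\<alpha> - d) * psi3 d - 2 * psi2 d) (at d)"
  by (auto intro!: derivative_eq_intros DERIV_psi2 simp: algebra_simps)

lemma foc_0 [simp]: "foc \<alpha> \<theta> 0 = \<alpha>"
  by (simp add: foc_def)

lemma isCont_foc: "isCont (foc \<alpha> \<theta>) x"
  using DERIV_foc DERIV_isCont by blast

text \<open>\<open>foc'' x / (2 * psi3 x) = \<alpha> - (x + psi2 x / psi3 x)\<close>, so monotonicity leaves at most one inflection point.\<close>

lemma inflection_strict_mono:
  assumes "0 \<le> x" "x < y"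
  shows "x + psi2 x / psi3 x < y + psi2 y / psi3 y"
proof (rule DERIV_pos_imp_increasing[OF assms(2), where f="\<lambda>x. x + psi2 x / psi3 x"])
  fix z assume "x \<le> z" "z \<le> y"
  then have z: "0 \<le> z" using assms by simp
  have "((\<lambda>x. x + psi2 x / psi3 x) has_real_derivative
      1 + (psi3 z * psi3 z - psi2 z * (z * psi3 z + 3 * psi2 z)) / (psi3 z * psi3 z)) (at z)"
    using psi3_pos[OF z] by (auto intro!: derivative_eq_intros DERIV_psi2 DERIV_psi3)
  moreover have "0 < 1 + (psi3 z * psi3 z - psi2 z * (z * psi3 z + 3 * psi2 z)) / (psi3 z * psi3 z)"
    using psi2_psi3_bound[OF z] psi3_pos[OF z] by (simp add: field_simps power2_eq_square)
  ultimately show "\<exists>D. ((\<lambda>x. x + psi2 x / psi3 x) has_real_derivative D) (at z) \<and> 0 < D" by blast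
qed

section \<open>Zeros of the first-order condition\<close>

text \<open>Rolle, applied twice: four zeros give three zeros of the derivative and two distinct
  nonnegative zeros of the second derivative. At both of them \<alpha> equals the injective function
  of \<open>inflection_strict_mono\<close>.\<close>

lemma foc_zeros:
  assumes "0 \<le> x1" "x1 < x2" "x2 < x3" "x3 < x4"
    and "foc \<alpha> \<theta> x1 = 0" "foc \<alpha> \<theta> x2 = 0" "foc \<alpha> \<theta> x3 = 0" "foc \<alpha> \<theta> x4 = 0"
  shows False
proof -
  define f' where "f' d = 2 * (\<alpha> - d) * psi2 d + 1 - \<theta>" for d
  have Df: "(foc \<alpha> \<theta> has_real_derivative f' d) (at d)" for d
    using DERIV_foc by (simp add: f'_def)
  have Df': "(f' has_real_derivative 2 * (\<alpha> - d) * psi3 d - 2 * psi2 d) (at d)" for d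
    using DERIV_foc' by (simp add: f'_def[abs_def])
  have rolle: "\<exists>z. a < z \<and> z < b \<and> g' z = 0"
    if "a < b" "g a = g b" "\<And>x. (g has_real_derivative g' x) (at x)" for a b :: real and g g' :: "real \<Rightarrow> real"
    using Rolle_deriv[OF that(1,2), of "\<lambda>x. (*) (g' x)"] that(3)
    by (metis DERIV_continuous_on has_field_derivative_def has_field_derivative_at_within mult.right_neutral)
  obtain y1 y2 y3 where y: "x1 < y1" "y1 < x2" "x2 < y2" "y2 < x3" "x3 < y3" "y3 < x4"
      "f' y1 = 0" "f' y2 = 0" "f' y3 = 0"
    using rolle[OF assms(2) _ Df] rolle[OF assms(3) _ Df] rolle[OF assms(4) _ Df] assms by metis
  obtain z1 z2 where z: "y1 < z1" "z1 < y2" "y2 < z2" 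
      "2 * (\<alpha> - z1) * psi3 z1 - 2 * psi2 z1 = 0" "2 * (\<alpha> - z2) * psi3 z2 - 2 * psi2 z2 = 0"
    using rolle[OF _ _ Df', of y1 y2] rolle[OF _ _ Df', of y2 y3] y by force
  have "\<alpha> = z + psi2 z / psi3 z"
    if "0 \<le> z" "2 * (\<alpha> - z) * psi3 z - 2 * psi2 z = 0" for z
    using psi3_pos[OF that(1)] that(2) by (simp add: field_simps)
  then show False
    using inflection_strict_mono[of z1 z2] z y assms(1) by (smt (verit))
qed

text \<open>As \<open>card\<close> of an infinite set is 0, finiteness is a claim of its own. Any
  violation, infinite or not, contains a subset of four elements, and its sorted list is the
  forbidden chain.\<close>

lemma finite_card_le_3:
  fixes S :: "'b::linorder set"
  assumes "\<And>x1 x2 x3 x4. \<lbrakk>x1 \<in> S; x2 \<in> S; x3 \<in> S; x4 \<in> S; x1 < x2; x2 < x3; x3 < x4\<rbrakk> \<Longrightarrow> False"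
  shows "finite S \<and> card S \<le> 3"
proof (rule ccontr)
  assume "\<not> ?thesis"
  then obtain T where T: "T \<subseteq> S" "card T = 4" "finite T"
    by (cases "finite S")
      (use infinite_arbitrarily_large[of S 4] obtain_subset_with_card_n[of 4 S] in auto)
  define l where "l = sorted_list_of_set T"
  have l: "sorted_wrt (<) l" "set l = T" "length l = 4"
    using T by (auto simp: l_def)
  then have "l ! 0 < l ! 1" "l ! 1 < l ! 2" "l ! 2 < l ! 3"
    "l ! 0 \<in> T" "l ! 1 \<in> T" "l ! 2 \<in> T" "l ! 3 \<in> T"
    by (auto simp: sorted_wrt_iff_nth_less)
  with assms T(1) show False by blast
qed

text \<open>The two bounds on \<theta> do different jobs. The one with
  \<open>psi (\<alpha> / 2)\<close> says exactly that \<open>foc\<close> is nonpositive at \<alpha>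
  / 2; the other one reads \<open>\<theta> \<ge> 1 + 2 * \<alpha> * psi2 \<alpha>\<close> and makes
  \<open>foc\<close> strictly decreasing from there on.\<close>

lemma foc_neg:
  assumes "0 < \<alpha>" "\<theta> \<ge> 1 + 2 * \<alpha> * (\<alpha> + (\<alpha>\<^sup>2 + 1) * psi \<alpha>)"
    "\<theta> \<ge> 1 + 1 / \<alpha> * (4 + \<alpha>\<^sup>2) * psi (\<alpha> / 2)" "\<alpha> / 2 < d"
  shows "foc \<alpha> \<theta> d < 0"
proof -
  have psi2: "psi2 \<alpha> = \<alpha> + (\<alpha>\<^sup>2 + 1) * psi \<alpha>"
    by (simp add: psi2_def psi1_def algebra_simps power2_eq_square)
  have "foc \<alpha> \<theta> (\<alpha>/2) = (1 + 1 / \<alpha> * (4 + \<alpha>\<^sup>2) * psi (\<alpha> / 2) - \<theta>) * (\<alpha> / 2)"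
    using assms(1) by (simp add: foc_def field_simps power2_eq_square)
  also have "\<dots> \<le> 0" using assms(1,3) by (simp add: mult_nonpos_nonneg)
  finally have "foc \<alpha> \<theta> (\<alpha>/2) \<le> 0" .
  moreover have "foc \<alpha> \<theta> d < foc \<alpha> \<theta> (\<alpha>/2)"
  proof (rule DERIV_neg_imp_decreasing[OF assms(4)])
    fix z assume z: "\<alpha> / 2 \<le> z" "z \<le> d"
    then have z0: "0 < z" using assms(1) by linarith
    have "2 * (\<alpha> - z) * psi2 z < 2 * \<alpha> * psi2 \<alpha>"
    proof (cases "z \<le> \<alpha>")
      case True
      have "2 * (\<alpha> - z) * psi2 z < 2 * \<alpha> * psi2 z" using psi2_pos[OF z0] z0 by simp
      also have "\<dots> \<le> 2 * \<alpha> * psi2 \<alpha>" using psi2_mono[of z \<alpha>] True z0 assms(1) by simp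
      finally show ?thesis .
    next
      case False
      then have "2 * (\<alpha> - z) * psi2 z < 0" using psi2_pos[OF z0] by (simp add: mult_neg_pos)
      also have "0 < 2 * \<alpha> * psi2 \<alpha>" using psi2_pos assms(1) by simp
      finally show ?thesis .
    qed
    with assms(2) psi2 have "2 * (\<alpha> - z) * psi2 z + 1 - \<theta> < 0" by simp
    then show "\<exists>D. (foc \<alpha> \<theta> has_real_derivative D) (at z) \<and> D < 0" using DERIV_foc by blast
  qed
  ultimately show ?thesis by simp
qed

text \<open>On \<open>[0, \<alpha>]\<close> the function stays above its value \<alpha> at 0. Beyond
  \<alpha> its derivative is strictly decreasing; it has to be negative somewhere before a first
  zero, hence stays negative, and no second zero can follow.\<close>

lemma foc_unique_zero:
  assumes "0 < \<alpha>" "0 < \<theta>" "\<theta> \<le> 1"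
  obtains d where "\<alpha> < d" "\<And>x. 0 \<le> x \<Longrightarrow> foc \<alpha> \<theta> x = 0 \<longleftrightarrow> x = d"
proof -
  have pos: "\<alpha> \<le> foc \<alpha> \<theta> x" if "0 \<le> x" "x \<le> \<alpha>" for x
  proof -
    have "foc \<alpha> \<theta> 0 \<le> foc \<alpha> \<theta> x"
    proof (rule DERIV_nonneg_imp_nondecreasing[OF that(1)])
      fix z assume z: "0 \<le> z" "z \<le> x"
      then have "0 \<le> 2 * (\<alpha> - z) * psi2 z" using that psi2_nonneg by simp
      then show "\<exists>D. (foc \<alpha> \<theta> has_real_derivative D) (at z) \<and> 0 \<le> D"
        using DERIV_foc[of \<alpha> \<theta> z] assms(3) by (intro exI[of _ "2 * (\<alpha> - z) * psi2 z + 1 - \<theta>"]) simp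
    qed
    then show ?thesis by simp
  qed
  \<comment> \<open>At \<open>d = \<alpha> + 1\<close> the quadratic
    \<open>1 + \<alpha> * d - d^2\<close> equals \<open>- \<alpha>\<close>, so every remaining term
    is negative.\<close>
  have neg: "foc \<alpha> \<theta> (\<alpha> + 1) < 0"
  proof -
    have "foc \<alpha> \<theta> (\<alpha> + 1) = - 2 * \<alpha> * psi (\<alpha> + 1) - 1 - \<theta> * (\<alpha> + 1)"
      by (simp add: foc_def algebra_simps power2_eq_square)
    moreover have "0 < \<alpha> * psi (\<alpha> + 1)" "0 < \<theta> * (\<alpha> + 1)" using assms psi_pos by auto
    ultimately show ?thesis by linarith
  qed
  obtain d where d: "\<alpha> \<le> d" "foc \<alpha> \<theta> d = 0"
    using IVT2[of "foc \<alpha> \<theta>" "\<alpha> + 1" 0 \<alpha>] pos[of \<alpha>] neg assms isCont_foc by fastforce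
  with pos[of \<alpha>] assms have "\<alpha> < d" by (cases "\<alpha> = d") auto
  define f' where "f' d = 2 * (\<alpha> - d) * psi2 d + 1 - \<theta>" for d
  have Df: "(foc \<alpha> \<theta> has_real_derivative f' d) (at d)" for d
    using DERIV_foc by (simp add: f'_def)
  have Df': "(f' has_real_derivative 2 * (\<alpha> - d) * psi3 d - 2 * psi2 d) (at d)" for d
    using DERIV_foc' by (simp add: f'_def[abs_def])
  have dec: "f' y < f' x" if "\<alpha> \<le> x" "x < y" for x y
  proof (rule DERIV_neg_imp_decreasing[OF that(2)])
    fix z assume "x \<le> z" "z \<le> y"
    then have "\<alpha> \<le> z" "0 < z" using that assms by auto
    then have "2 * (\<alpha> - z) * psi3 z \<le> 0" "0 < psi2 z"
      using psi3_pos[of z] psi2_pos[of z] by (auto simp: mult_nonpos_nonneg)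
    then show "\<exists>D. (f' has_real_derivative D) (at z) \<and> D < 0" using Df' by fastforce
  qed
  have uniq: False if xy: "\<alpha> < x" "x < y" "foc \<alpha> \<theta> x = 0" "foc \<alpha> \<theta> y = 0" for x y
  proof -
    obtain z where z: "\<alpha> < z" "z < x" "foc \<alpha> \<theta> x - foc \<alpha> \<theta> \<alpha> = (x - \<alpha>) * f' z"
      using MVT2[OF xy(1) Df] by auto
    obtain w where w: "x < w" "w < y" "foc \<alpha> \<theta> y - foc \<alpha> \<theta> x = (y - x) * f' w"
      using MVT2[OF xy(2) Df] by auto
    have "f' w = 0" using w xy by simp
    moreover have "f' z < 0" using z xy pos[of \<alpha>] assms
      by (smt (verit) mult_nonneg_nonneg)
    ultimately show False using dec[of z w] z w by simp
  qed
  show thesis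
  proof (rule that[OF \<open>\<alpha> < d\<close>])
    fix x :: real assume "0 \<le> x"
    show "foc \<alpha> \<theta> x = 0 \<longleftrightarrow> x = d"
    proof
      assume 0: "foc \<alpha> \<theta> x = 0"
      then have "\<alpha> < x" using pos[of x] \<open>0 \<le> x\<close> assms by force
      with 0 uniq[of x d] uniq[of d x] d \<open>\<alpha> < d\<close> show "x = d" by (cases x d rule: linorder_cases) auto
    qed (use d in auto)
  qed
qed


section \<open>Best responses to a threshold\<close>

text \<open>\<open>response \<alpha> \<theta> d b\<close> is, up to an increasing affine map that does not depend on \<open>b\<close>, the payoff of
  the threshold \<open>b\<close> against \<open>d\<close> (\<open>R1_value\<close> below); \<open>slope\<close> has the sign of its derivative.\<close>

definition response :: "real \<Rightarrow> real \<Rightarrow> real \<Rightarrow> real \<Rightarrow> real" where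
  "response \<alpha> \<theta> d b = ((b - \<alpha>) * exp (- b\<^sup>2 / 2) + \<theta> * d * exp (- d\<^sup>2 / 2)) / (gauss_int b + gauss_int d)"

definition slope :: "real \<Rightarrow> real \<Rightarrow> real \<Rightarrow> real \<Rightarrow> real" where
  "slope \<alpha> \<theta> d b = (1 + \<alpha> * b - b\<^sup>2) * (gauss_int b + gauss_int d)
     - (b - \<alpha>) * exp (- b\<^sup>2 / 2) - \<theta> * d * exp (- d\<^sup>2 / 2)"

lemma DERIV_response:
  assumes "0 \<le> b" "0 < d"
  shows "(response \<alpha> \<theta> d has_real_derivative
    exp (- b\<^sup>2 / 2) * slope \<alpha> \<theta> d b / (gauss_int b + gauss_int d)\<^sup>2) (at b)"
proof -
  have "gauss_int b + gauss_int d \<noteq> 0"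
    using gauss_int_pos[OF assms(2)] gauss_int_mono[OF assms(1)] by simp
  then show ?thesis
    unfolding response_def[abs_def] slope_def
    by (auto intro!: derivative_eq_intros has_real_derivative_gauss_int
        simp: field_simps power2_eq_square)
qed

text \<open>The exponential terms cancel, and for \<open>b \<ge> 0\<close> and \<open>d > 0\<close>
  the rest has the sign of \<open>\<alpha> - 2 * b\<close>. So \<open>slope\<close> turns at
  \<alpha> / 2 for every \<open>d\<close>, which is the source of the two monotonicity lemmas
  below.\<close>

lemma DERIV_slope:
  "(slope \<alpha> \<theta> d has_real_derivative (\<alpha> - 2 * b) * (gauss_int b + gauss_int d)) (at b)"
  unfolding slope_def[abs_def]
  by (auto intro!: derivative_eq_intros has_real_derivative_gauss_int
      simp: algebra_simps power2_eq_square)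

lemma slope_diag: "slope \<alpha> \<theta> d d = exp (- d\<^sup>2 / 2) * foc \<alpha> \<theta> d"
proof -
  have "exp (- d\<^sup>2 / 2) * exp (d\<^sup>2 / 2) = 1" by (simp flip: exp_add)
  then have "exp (- d\<^sup>2 / 2) * psi d = gauss_int d"
    by (simp add: psi_eq flip: mult.assoc)
  moreover have "exp (- d\<^sup>2 / 2) * foc \<alpha> \<theta> d =
      2 * (1 + \<alpha> * d - d\<^sup>2) * (exp (- d\<^sup>2 / 2) * psi d) + exp (- d\<^sup>2 / 2) * (\<alpha> - (1 + \<theta>) * d)"
    by (simp add: foc_def algebra_simps)
  ultimately show ?thesis by (simp add: slope_def algebra_simps)
qed

context
  fixes \<alpha> \<theta> d :: real
  assumes \<alpha>: "0 < \<alpha>" and d: "0 < d"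
begin

lemma slope_increasing:
  assumes "0 \<le> x" "x < y" "y \<le> \<alpha> / 2"
  shows "slope \<alpha> \<theta> d x < slope \<alpha> \<theta> d y"
proof (rule DERIV_pos_imp_increasing_open[OF assms(2)])
  fix z assume "x < z" "z < y"
  with assms have "0 < (\<alpha> - 2 * z) * (gauss_int z + gauss_int d)"
    using gauss_int_pos[OF d] gauss_int_pos[of z] by simp
  then show "\<exists>D. (slope \<alpha> \<theta> d has_real_derivative D) (at z) \<and> 0 < D"
    using DERIV_slope by blast
qed (auto intro!: continuous_at_imp_continuous_on DERIV_isCont[OF DERIV_slope])

lemma slope_decreasing:
  assumes "\<alpha> / 2 \<le> x" "x < y"
  shows "slope \<alpha> \<theta> d y < slope \<alpha> \<theta> d x"
proof (rule DERIV_neg_imp_decreasing_open[OF assms(2)])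
  fix z assume "x < z" "z < y"
  with assms have "(\<alpha> - 2 * z) * (gauss_int z + gauss_int d) < 0"
    using gauss_int_pos[OF d] gauss_int_pos[of z] \<alpha> by (simp add: mult_neg_pos)
  then show "\<exists>D. (slope \<alpha> \<theta> d has_real_derivative D) (at z) \<and> D < 0"
    using DERIV_slope by blast
qed (auto intro!: continuous_at_imp_continuous_on DERIV_isCont[OF DERIV_slope])

lemma response_mono:
  assumes "0 \<le> x" "x \<le> y" "\<And>z. x \<le> z \<Longrightarrow> z \<le> y \<Longrightarrow> 0 \<le> slope \<alpha> \<theta> d z"
  shows "response \<alpha> \<theta> d x \<le> response \<alpha> \<theta> d y"
proof (rule DERIV_nonneg_imp_nondecreasing[OF assms(2)])
  fix z assume "x \<le> z" "z \<le> y"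
  then show "\<exists>D. (response \<alpha> \<theta> d has_real_derivative D) (at z) \<and> 0 \<le> D"
    using DERIV_response[of z d \<alpha> \<theta>] d assms by (force intro!: exI)
qed

lemma response_antimono:
  assumes "0 \<le> x" "x \<le> y" "\<And>z. x \<le> z \<Longrightarrow> z \<le> y \<Longrightarrow> slope \<alpha> \<theta> d z \<le> 0"
  shows "response \<alpha> \<theta> d y \<le> response \<alpha> \<theta> d x"
proof (rule DERIV_nonpos_imp_nonincreasing[OF assms(2)])
  fix z assume "x \<le> z" "z \<le> y"
  then show "\<exists>D. (response \<alpha> \<theta> d has_real_derivative D) (at z) \<and> D \<le> 0"
    using DERIV_response[of z d \<alpha> \<theta>] d assms
    by (intro exI conjI, force) (auto intro!: divide_nonpos_nonneg mult_nonneg_nonpos)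
qed

text \<open>An interior maximum at \<open>d\<close> forces \<open>slope\<close> to vanish there. If
  \<open>d\<close> were at most \<alpha> / 2, \<open>slope\<close> would increase to this zero and
  be negative before it, so \<open>response\<close> would fall on all of \<open>[0, d]\<close> and
  the threshold 0 would do better.\<close>

lemma best_response_imp_foc:
  assumes max: "\<And>b. 0 \<le> b \<Longrightarrow> response \<alpha> \<theta> d b \<le> response \<alpha> \<theta> d d"
  shows "foc \<alpha> \<theta> d = 0 \<and> \<alpha> / 2 < d"
proof -
  have pos: "gauss_int b + gauss_int d > 0" if "0 \<le> b" for b
    using gauss_int_pos[OF d] gauss_int_mono[OF that] by simp
  \<comment> \<open>The radius \<open>d\<close> keeps the neighbourhood of the local maximum inside
    the admissible thresholds.\<close>
  have "exp (- d\<^sup>2 / 2) * slope \<alpha> \<theta> d d / (gauss_int d + gauss_int d)\<^sup>2 = 0"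
    by (rule DERIV_local_max[OF DERIV_response[OF less_imp_le[OF d] d] d]) (use max d in auto)
  then have 0: "slope \<alpha> \<theta> d d = 0" using gauss_int_pos[OF d] by simp
  have "\<alpha> / 2 < d"
  proof (rule ccontr)
    assume "\<not> \<alpha> / 2 < d"
    then have neg: "slope \<alpha> \<theta> d z < 0" if "0 \<le> z" "z < d" for z
      using slope_increasing[of z d] 0 that by simp
    have "response \<alpha> \<theta> d d < response \<alpha> \<theta> d 0"
    proof (rule DERIV_neg_imp_decreasing_open[OF d])
      fix z assume "0 < z" "z < d"
      then show "\<exists>D. (response \<alpha> \<theta> d has_real_derivative D) (at z) \<and> D < 0"
        using DERIV_response[of z d \<alpha> \<theta>] d neg[of z] pos[of z]
        by (intro exI conjI, force) (auto intro!: divide_neg_pos mult_pos_neg)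
    qed (auto intro!: continuous_at_imp_continuous_on DERIV_isCont[OF DERIV_response] d)
    with max[of 0] show False by simp
  qed
  with 0 show ?thesis by (simp add: slope_diag)
qed

text \<open>Beyond \<open>d\<close> the response decreases; on \<open>[0, d]\<close> it is
  increasing, or first decreasing and then increasing. So only 0 can beat \<open>d\<close>, and
  \<open>cond\<close> is the inequality \<open>response \<alpha> \<theta> d 0 \<le> response
  \<alpha> \<theta> d d\<close> after clearing the denominator and the factor
  \<open>exp (- d^2 / 2)\<close>.\<close>

lemma foc_imp_best_response:
  assumes foc: "foc \<alpha> \<theta> d = 0" and "\<alpha> / 2 < d"
    and cond: "0 \<le> d - \<alpha> - \<theta> * d + 2 * \<alpha> * exp (d\<^sup>2 / 2)" and "0 \<le> b"
  shows "response \<alpha> \<theta> d b \<le> response \<alpha> \<theta> d d"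
proof -
  have 0: "slope \<alpha> \<theta> d d = 0" by (simp add: slope_diag foc)
  have response_0: "response \<alpha> \<theta> d 0 \<le> response \<alpha> \<theta> d d"
  proof -
    have "0 \<le> exp (- d\<^sup>2 / 2) * (d - \<alpha> - \<theta> * d + 2 * \<alpha> * exp (d\<^sup>2 / 2))" using cond by simp
    also have "\<dots> = (d - \<alpha>) * exp (- d\<^sup>2 / 2) - \<theta> * d * exp (- d\<^sup>2 / 2) + 2 * \<alpha>"
      by (simp add: algebra_simps flip: exp_add)
    finally have "2 * (- \<alpha> + \<theta> * d * exp (- d\<^sup>2 / 2)) / (2 * gauss_int d)
        \<le> ((d - \<alpha>) * exp (- d\<^sup>2 / 2) + \<theta> * d * exp (- d\<^sup>2 / 2)) / (2 * gauss_int d)"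
      using gauss_int_pos[OF d] by (intro divide_right_mono) auto
    moreover have "response \<alpha> \<theta> d 0 = 2 * (- \<alpha> + \<theta> * d * exp (- d\<^sup>2 / 2)) / (2 * gauss_int d)"
      unfolding mult_divide_mult_cancel_left_if by (simp add: response_def)
    ultimately show ?thesis by (simp add: response_def)
  qed
  consider "d \<le> b" | "b < d" "0 \<le> slope \<alpha> \<theta> d b" | "b < d" "slope \<alpha> \<theta> d b < 0" by linarith
  then show ?thesis
  proof cases
    case 1
    then show ?thesis
      using slope_decreasing[of d] 0 assms(2) d
      by (intro response_antimono) (force simp: le_less)+
  next
    case 2
    have "0 \<le> slope \<alpha> \<theta> d z" if "b \<le> z" "z \<le> d" for z
      using slope_increasing[of b z] slope_decreasing[of z d] 2 0 that \<open>0 \<le> b\<close>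
      by (cases "z \<le> \<alpha> / 2"; cases "b = z"; cases "z = d") auto
    with 2 \<open>0 \<le> b\<close> show ?thesis by (intro response_mono) auto
  next
    case 3
    \<comment> \<open>Between \<alpha> / 2 and \<open>d\<close> the slope lies above its zero at
      \<open>d\<close>. A negative slope thus puts \<open>b\<close> on the increasing branch, where
      the slope is negative further left as well.\<close>
    then have "b < \<alpha> / 2" using slope_decreasing[of b d] 0 by force
    then have "slope \<alpha> \<theta> d z \<le> 0" if "0 \<le> z" "z \<le> b" for z
      using slope_increasing[of z b] 3 that by (cases "z = b") auto
    with \<open>0 \<le> b\<close> have "response \<alpha> \<theta> d b \<le> response \<alpha> \<theta> d 0" by (intro response_antimono) auto
    with response_0 show ?thesis by simp
  qed
qed

end

section \<open>Explicit bounds and a pair of parameters with two equilibria\<close>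

lemma psi_ge: assumes "0 \<le> x" shows "x \<le> psi x"
proof -
  have "psi 0 - 0 \<le> psi x - x"
  proof (rule DERIV_nonneg_imp_nondecreasing[OF assms, where f="\<lambda>x. psi x - x"])
    fix z :: real assume "0 \<le> z"
    have "((\<lambda>x. psi x - x) has_real_derivative psi1 z - 1) (at z)"
      by (auto intro!: derivative_eq_intros DERIV_psi)
    with psi1_ge_1[OF \<open>0 \<le> z\<close>]
    show "\<exists>D. ((\<lambda>x. psi x - x) has_real_derivative D) (at z) \<and> 0 \<le> D" by force
  qed
  then show ?thesis by simp
qed

text \<open>By \<open>(z - 1)^2 \<ge> 0\<close> the integrand is at most
  \<open>exp (1/2) * exp (- z)\<close>, whose integral over the half line is
  \<open>exp (1/2) \<le> 2\<close>. The bound serves the numerical example and the convergence of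
  \<open>gauss_int\<close> at infinity.\<close>

lemma gauss_int_le: assumes "0 \<le> x" shows "gauss_int x \<le> 2"
proof -
  have "gauss_int 0 + exp (1/2) * exp (- 0) \<ge> gauss_int x + exp (1/2) * exp (- x)"
  proof (rule DERIV_nonpos_imp_nonincreasing[OF assms, where f="\<lambda>x. gauss_int x + exp (1/2) * exp (- x)"])
    fix z :: real
    have "- z\<^sup>2 / 2 \<le> 1 / 2 + - z"
      using zero_le_power2[of "z - 1"] by (simp add: power2_eq_square algebra_simps)
    then have "exp (- z\<^sup>2 / 2) \<le> exp (1/2) * exp (- z)"
      by (simp flip: exp_add)
    moreover have "((\<lambda>x. gauss_int x + exp (1/2) * exp (- x)) has_real_derivative
        exp (- z\<^sup>2 / 2) - exp (1/2) * exp (- z)) (at z)"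
      by (auto intro!: derivative_eq_intros has_real_derivative_gauss_int)
    ultimately show "\<exists>D. ((\<lambda>x. gauss_int x + exp (1/2) * exp (- x)) has_real_derivative D) (at z) \<and> D \<le> 0"
      by force
  qed
  moreover have "exp (1/2::real) \<le> 2"
    using exp_bound[of "1/2"] by (simp add: power2_eq_square)
  moreover have "0 < exp (1/2) * exp (- x)" by simp
  ultimately show ?thesis unfolding gauss_int_0 minus_zero exp_zero by linarith
qed

text \<open>\<open>\<theta>\<close> is chosen so that \<open>d = \<alpha>\<close> is an equilibrium; there \<open>foc\<close> has slope \<open>1 - \<theta> < 0\<close>, and it is
  negative a little further to the left.\<close>

lemma two_solutions:
  defines "\<theta> \<equiv> psi 8 / 4"
  obtains d where "63 / 8 < d" "d < 8" "foc 8 \<theta> d = 0" "foc 8 \<theta> 8 = 0" "0 < \<theta>"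
    "\<And>x. 63 / 8 \<le> x \<Longrightarrow> x \<le> 8 \<Longrightarrow> 0 \<le> x - 8 - \<theta> * x + 2 * 8 * exp (x\<^sup>2 / 2)"
proof -
  have psi8: "8 \<le> psi 8" by (rule psi_ge) simp
  have "foc 8 \<theta> 8 = 0" by (simp add: foc_def \<theta>_def)
  \<comment> \<open>\<open>127 / 128\<close> is \<open>(8^2 - (63/8)^2) / 2\<close>; as
    \<open>gauss_int\<close> is increasing, \<open>psi\<close> grows at least by the factor
    \<open>exp (127 / 128)\<close> from \<open>63 / 8\<close> to 8.\<close>
  have exp: "exp ((8::real)\<^sup>2 / 2) = exp (127 / 128) * exp ((63 / 8)\<^sup>2 / 2)"
    by (simp add: power2_eq_square flip: exp_add)
  \<comment> \<open>The quadratic Taylor polynomial is about 2.484, and \<open>81/100\<close> is a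
    round factor that keeps the product above 2.\<close>
  have lower: "2 \<le> exp (127 / 128 :: real) * (81/100)"
    using exp_lower_Taylor_quadratic[of "127/128"] by (simp add: power2_eq_square)
  have "psi (63/8) * exp (127 / 128) = exp ((8::real)\<^sup>2 / 2) * gauss_int (63/8)"
    unfolding psi_eq exp by simp
  also have "\<dots> \<le> psi 8" unfolding psi_eq using gauss_int_mono[of "63/8" 8] by simp
  finally have le: "psi (63/8) * exp (127 / 128) \<le> psi 8" .
  have "2 * psi (63/8) \<le> psi (63/8) * exp (127 / 128) * (81/100)"
    using mult_left_mono[OF lower psi_nonneg[of "63/8"]] by (simp add: algebra_simps)
  with le have "2 * psi (63/8) \<le> psi 8 * (81/100)" by simp
  \<comment> \<open>Here \<open>foc\<close> equals
    \<open>127/32 * psi (63/8) + 1/8 - 63/32 * psi 8\<close>, and the previous bound makes the first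
    term smaller than \<open>1.61 * psi 8\<close>.\<close>
  with psi8 have neg: "foc 8 \<theta> (63/8) < 0"
    by (simp add: foc_def \<theta>_def power2_eq_square field_simps)
  have "DERIV (foc 8 \<theta>) 8 :> 1 - \<theta>" using DERIV_foc[of 8 \<theta> 8] by simp
  moreover have "1 - \<theta> < 0" using psi8 by (simp add: \<theta>_def)
  ultimately obtain e where e: "0 < e" "\<And>h. 0 < h \<Longrightarrow> h < e \<Longrightarrow> foc 8 \<theta> 8 < foc 8 \<theta> (8 - h)"
    using DERIV_neg_dec_left by blast
  define h where "h = min (e / 2) (1 / 16)"
  have h: "0 < h" "h < e" "h < 1 / 8" using e(1) by (auto simp: h_def)
  then have "0 < foc 8 \<theta> (8 - h)" using e(2) \<open>foc 8 \<theta> 8 = 0\<close> by metis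
  then obtain d where d: "63/8 \<le> d" "d \<le> 8 - h" "foc 8 \<theta> d = 0"
    using IVT[of "foc 8 \<theta>" "63/8" 0 "8 - h"] neg isCont_foc h by fastforce
  have "d \<noteq> 63/8" using d(3) neg by (metis less_irrefl)
  \<comment> \<open>As \<theta> > 1, replacing \<open>x\<close> by 8 in
    \<open>(\<theta> - 1) * x\<close> bounds the expression below by
    \<open>16 * exp (x^2 / 2) - 2 * psi 8\<close>. Then \<open>gauss_int 8 \<le> 2\<close> and
    \<open>exp (127 / 128) \<le> 4\<close> suffice.\<close>
  have cond: "0 \<le> x - 8 - \<theta> * x + 2 * 8 * exp (x\<^sup>2 / 2)" if x: "63 / 8 \<le> x" "x \<le> 8" for x
  proof -
    have "exp (127 / 128 :: real) \<le> 4"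
      using exp_le order.trans[of "exp (127 / 128 :: real)" "exp 1" 3] by simp
    have "psi 8 \<le> exp ((8::real)\<^sup>2 / 2) * 2"
      unfolding psi_eq using gauss_int_le[of 8] by simp
    also have "\<dots> \<le> 8 * exp ((63 / 8)\<^sup>2 / 2)"
      unfolding exp using \<open>exp (127 / 128 :: real) \<le> 4\<close> by simp
    also have "\<dots> \<le> 8 * exp (x\<^sup>2 / 2)" using x power_mono[of "63/8" x 2] by simp
    finally have "psi 8 \<le> 8 * exp (x\<^sup>2 / 2)" .
    moreover have "(\<theta> - 1) * x \<le> (\<theta> - 1) * 8"
      using x psi8 by (intro mult_left_mono) (auto simp: \<theta>_def)
    ultimately show ?thesis by (simp add: \<theta>_def algebra_simps)
  qed
  show thesis
    by (rule that[of d]) (use d \<open>d \<noteq> 63/8\<close> h psi8 cond \<open>foc 8 \<theta> 8 = 0\<close> in \<open>auto simp: \<theta>_def\<close>)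
qed

section \<open>Optional stopping for the exponential martingales\<close>

lemma has_bochner_integral_cmult:
  fixes f :: "'b \<Rightarrow> real"
  shows "has_bochner_integral M f x \<Longrightarrow> has_bochner_integral M (\<lambda>\<omega>. c * f \<omega>) (c * x)"
  by (rule has_bochner_integral_mult_right)

text \<open>Completing the square: an exponential tilt moves the mean to \<open>a * v\<close>, and
  the prefactor is the moment generating function.\<close>

lemma normal_density_exp_shift:
  assumes "0 < v"
  shows "normal_density 0 (sqrt v) x * exp (a * x) = exp (a\<^sup>2 * v / 2) * normal_density (a * v) (sqrt v) x"
proof -
  have "a * x - x\<^sup>2 / (2 * v) = a\<^sup>2 * v / 2 - (x - a * v)\<^sup>2 / (2 * v)"
    using assms by (simp add: field_simps power2_eq_square)
  then have "exp (- x\<^sup>2 / (2 * v)) * exp (a * x) = exp (a\<^sup>2 * v / 2) * exp (- (x - a * v)\<^sup>2 / (2 * v))"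
    by (simp flip: exp_add)
  then show ?thesis
    using assms by (simp add: normal_density_def)
qed

lemma gaussian_law_exp:
  assumes "0 \<le> v"
  shows "has_bochner_integral (gaussian_law 0 v) (\<lambda>x. exp (a * x)) (exp (a\<^sup>2 * v / 2))"
proof (cases "v = 0")
  case True
  then show ?thesis
    by (simp add: gaussian_law_def has_bochner_integral_iff integral_return integrable_iff_bounded nn_integral_return)
next
  case False
  then have v: "0 < v" using assms by simp
  have "has_bochner_integral lborel (normal_density (a * v) (sqrt v)) 1"
    using v by (simp add: has_bochner_integral_iff)
  from has_bochner_integral_cmult[OF this, of "exp (a\<^sup>2 * v / 2)"]
  have "has_bochner_integral lborel (\<lambda>x. normal_density 0 (sqrt v) x *\<^sub>R exp (a * x)) (exp (a\<^sup>2 * v / 2))"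
    by (simp add: normal_density_exp_shift[OF v])
  then show ?thesis
    using False by (auto simp: gaussian_law_def intro!: has_bochner_integral_density)
qed

lemma (in prob_space) fatou_real:
  fixes f :: "nat \<Rightarrow> 'a \<Rightarrow> real"
  assumes "\<And>n. integrable M (f n)" "\<And>n \<omega>. \<omega> \<in> space M \<Longrightarrow> 0 \<le> f n \<omega>" "\<And>n. expectation (f n) \<le> C"
    and lim: "\<And>\<omega>. \<omega> \<in> space M \<Longrightarrow> (\<lambda>n. f n \<omega>) \<longlonglongrightarrow> g \<omega>"
  shows "integrable M g \<and> expectation g \<le> C"
proof -
  have g[measurable]: "g \<in> borel_measurable M"
    by (rule borel_measurable_LIMSEQ_real[OF lim]) (use assms(1) in auto)
  have g0: "AE \<omega> in M. 0 \<le> g \<omega>"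
    using LIMSEQ_le_const[OF lim] assms(2) by (intro AE_I2) blast
  have C: "0 \<le> C" using assms(2,3) by (meson Bochner_Integration.integral_nonneg order_trans)
  have "(\<integral>\<^sup>+\<omega>. ennreal (g \<omega>) \<partial>M) = (\<integral>\<^sup>+\<omega>. liminf (\<lambda>n. ennreal (f n \<omega>)) \<partial>M)"
    by (intro nn_integral_cong lim_imp_Liminf[symmetric] tendsto_ennrealI lim) auto
  also have "\<dots> \<le> liminf (\<lambda>n. \<integral>\<^sup>+\<omega>. ennreal (f n \<omega>) \<partial>M)"
    by (rule nn_integral_liminf) (use assms(1) in auto)
  also have "\<dots> = liminf (\<lambda>n. ennreal (expectation (f n)))"
    using assms(1,2) by (subst nn_integral_eq_integral) auto
  also have "\<dots> \<le> liminf (\<lambda>n. ennreal C)"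
    by (intro Liminf_mono always_eventually allI ennreal_leI assms)
  finally have le: "(\<integral>\<^sup>+\<omega>. ennreal (g \<omega>) \<partial>M) \<le> ennreal C" by (simp add: Liminf_const)
  then have int: "integrable M g"
    using g0 by (intro integrableI_nonneg) (auto simp: less_top[symmetric] top_unique)
  moreover have "expectation g \<le> C"
    using le C int g0 by (simp add: nn_integral_eq_integral)
  ultimately show ?thesis by simp
qed

text \<open>Fatou's lemma, applied to \<open>\<epsilon> f\<^sup>2 - f + 1 / (4 \<epsilon>) \<ge> 0\<close> as well as to \<open>f\<close> and \<open>f\<^sup>2\<close>,
  replaces Vitali's theorem.\<close>

lemma (in prob_space) integral_limit_L2_bounded:
  fixes f :: "nat \<Rightarrow> 'a \<Rightarrow> real"
  assumes int: "\<And>n. integrable M (f n)" and int2: "\<And>n. integrable M (\<lambda>\<omega>. (f n \<omega>)\<^sup>2)"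
    and nonneg: "\<And>n \<omega>. \<omega> \<in> space M \<Longrightarrow> 0 \<le> f n \<omega>"
    and eq: "\<And>n. expectation (f n) = c" and bound: "\<And>n. expectation (\<lambda>\<omega>. (f n \<omega>)\<^sup>2) \<le> B"
    and lim: "\<And>\<omega>. \<omega> \<in> space M \<Longrightarrow> (\<lambda>n. f n \<omega>) \<longlonglongrightarrow> g \<omega>"
  shows "integrable M g \<and> expectation g = c"
proof -
  have g: "integrable M g" "expectation g \<le> c"
    using fatou_real[OF int nonneg _ lim, of c] eq by auto
  have g2: "integrable M (\<lambda>\<omega>. (g \<omega>)\<^sup>2)"
    using fatou_real[where f="\<lambda>n \<omega>. (f n \<omega>)\<^sup>2" and g="\<lambda>\<omega>. (g \<omega>)\<^sup>2", OF int2 _ bound] lim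
    by (simp add: tendsto_power)
  have "c \<le> expectation g + e" if "0 < e" for e
  proof -
    define \<epsilon> where "\<epsilon> = e / (\<bar>B\<bar> + 1)"
    have \<epsilon>: "0 < \<epsilon>" "\<epsilon> * B \<le> e"
    proof -
      have "e * B \<le> e * (\<bar>B\<bar> + 1)" using that by (intro mult_left_mono) auto
      then show "0 < \<epsilon>" "\<epsilon> * B \<le> e" using that by (auto simp: \<epsilon>_def field_simps)
    qed
    \<comment> \<open>Here \<open>g\<close> enters with a minus sign, so Fatou's upper bound becomes
      the missing lower bound on \<open>expectation g\<close>.\<close>
    have "expectation (\<lambda>\<omega>. \<epsilon> * (g \<omega>)\<^sup>2 - g \<omega> + 1 / (4 * \<epsilon>)) \<le> \<epsilon> * B - c + 1 / (4 * \<epsilon>)"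
    proof (rule fatou_real[THEN conjunct2])
      fix n \<omega>
      show "0 \<le> \<epsilon> * (f n \<omega>)\<^sup>2 - f n \<omega> + 1 / (4 * \<epsilon>)"
      proof -
        have "0 \<le> (2 * \<epsilon> * f n \<omega> - 1)\<^sup>2 / (4 * \<epsilon>)" using \<epsilon>(1) by simp
        also have "\<dots> = \<epsilon> * (f n \<omega>)\<^sup>2 - f n \<omega> + 1 / (4 * \<epsilon>)"
          using \<epsilon>(1) by (simp add: field_simps power2_eq_square)
        finally show ?thesis .
      qed
      show "integrable M (\<lambda>\<omega>. \<epsilon> * (f n \<omega>)\<^sup>2 - f n \<omega> + 1 / (4 * \<epsilon>))"
        using int int2 by simp
      show "expectation (\<lambda>\<omega>. \<epsilon> * (f n \<omega>)\<^sup>2 - f n \<omega> + 1 / (4 * \<epsilon>)) \<le> \<epsilon> * B - c + 1 / (4 * \<epsilon>)"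
        using int int2 bound[of n] eq[of n] \<epsilon>(1) by (simp add: prob_space)
    next
      fix \<omega> assume "\<omega> \<in> space M"
      then show "(\<lambda>n. \<epsilon> * (f n \<omega>)\<^sup>2 - f n \<omega> + 1 / (4 * \<epsilon>)) \<longlonglongrightarrow> \<epsilon> * (g \<omega>)\<^sup>2 - g \<omega> + 1 / (4 * \<epsilon>)"
        by (intro tendsto_intros lim)
    qed
    then have "\<epsilon> * expectation (\<lambda>\<omega>. (g \<omega>)\<^sup>2) - expectation g \<le> \<epsilon> * B - c"
      using g g2 by (simp add: prob_space)
    moreover have "0 \<le> \<epsilon> * expectation (\<lambda>\<omega>. (g \<omega>)\<^sup>2)" using \<epsilon>(1) by simp
    ultimately show ?thesis using \<epsilon>(2) by linarith
  qed
  then have "c \<le> expectation g" by (rule field_le_epsilon)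
  with g show ?thesis by simp
qed

section \<open>The exponential martingale of the bridge\<close>

context brownian_bridge
begin

lemma sets_F_subset: "t \<in> {0..1} \<Longrightarrow> sets (F t) \<subseteq> sets M"
  using subalgebra_F by (simp add: subalgebra_def)

lemma measurable_F_M: "t \<in> {0..1} \<Longrightarrow> f \<in> borel_measurable (F t) \<Longrightarrow> f \<in> borel_measurable M"
  using subalgebra_F measurable_from_subalg by blast

lemma measurable_X: "t \<in> {0..1} \<Longrightarrow> X t \<in> borel_measurable M"
  using adapted measurable_F_M by blast

lemma distr_X: assumes "t \<in> {0..1}" shows "distr M borel (X t) = gaussian_law 0 (t - t * t)"
  using gaussian[of "{t}" "\<lambda>_. 1"] assms by simp

lemma exp_X: assumes "t \<in> {0..1}"
  shows "has_bochner_integral M (\<lambda>\<omega>. exp (a * X t \<omega>)) (exp (a\<^sup>2 * (t - t * t) / 2))"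
proof -
  have "0 \<le> t - t * t" using assms by (simp add: mult_left_le)
  from gaussian_law_exp[OF this, of a]
  have "has_bochner_integral (distr M borel (X t)) (\<lambda>x. exp (a * x)) (exp (a\<^sup>2 * (t - t * t) / 2))"
    by (simp add: distr_X[OF assms])
  then show ?thesis
    using measurable_X[OF assms] by (simp add: has_bochner_integral_iff integrable_distr_eq integral_distr)
qed

text \<open>The residual is a linear combination of \<open>X s\<close> and \<open>X t\<close>, hence
  centred Gaussian; its variance is that at time \<open>t\<close> of a bridge pinned at times
  \<open>s\<close> and 1.\<close>

lemma exp_residual: assumes "0 \<le> s" "s < t" "t < 1"
  shows "has_bochner_integral M (\<lambda>\<omega>. exp (a * (X t \<omega> - (1 - t) / (1 - s) * X s \<omega>)))
           (exp (a\<^sup>2 * ((t - s) * (1 - t) / (1 - s)) / 2))"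
proof -
  define \<kappa> where "\<kappa> = (1 - t) / (1 - s)"
  let ?v = "(t - s) * (1 - t) / (1 - s)"
  \<comment> \<open>The weights in the form that \<open>gaussian\<close> expects;
    \<open>s < t\<close> makes the two indices distinct.\<close>
  define c where "c u = (if u = t then 1 else - \<kappa>)" for u
  have v: "0 \<le> ?v" using assms by simp
  have "(\<Sum>r\<in>{s,t}. \<Sum>u\<in>{s,t}. c r * c u * (min r u - r * u))
      = \<kappa> * \<kappa> * (s - s * s) - 2 * \<kappa> * (s - s * t) + (t - t * t)"
    using assms by (simp add: c_def algebra_simps)
  also have "\<dots> = ?v"
    using assms unfolding \<kappa>_def by (simp add: divide_simps) (simp add: algebra_simps power2_eq_square)
  finally have var: "(\<Sum>r\<in>{s,t}. \<Sum>u\<in>{s,t}. c r * c u * (min r u - r * u)) = ?v" .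
  have N: "(\<Sum>u\<in>{s,t}. c u * X u \<omega>) = X t \<omega> - \<kappa> * X s \<omega>" for \<omega>
    using assms by (simp add: c_def)
  have "distr M borel (\<lambda>\<omega>. X t \<omega> - \<kappa> * X s \<omega>) = gaussian_law 0 ?v"
    using gaussian[of "{s,t}" c] assms unfolding N var by simp
  with gaussian_law_exp[OF v, of a]
  have "has_bochner_integral (distr M borel (\<lambda>\<omega>. X t \<omega> - \<kappa> * X s \<omega>)) (\<lambda>x. exp (a * x)) (exp (a\<^sup>2 * ?v / 2))"
    by simp
  moreover have "(\<lambda>\<omega>. X t \<omega> - \<kappa> * X s \<omega>) \<in> borel_measurable M"
    using measurable_X[of s] measurable_X[of t] assms by simp
  ultimately show ?thesis
    by (simp add: has_bochner_integral_iff integrable_distr_eq integral_distr \<kappa>_def)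
qed

text \<open>\<open>X\<^sub>t / (1 - t)\<close> is a Brownian motion at time \<open>t / (1 - t)\<close>; this is its exponential martingale.\<close>

definition expmart :: "real \<Rightarrow> real \<Rightarrow> 'a \<Rightarrow> real" where
  "expmart a t \<omega> = exp (a * (X t \<omega> / (1 - t)) - a\<^sup>2 * (t / (1 - t)) / 2)"

lemma expmart_eq: "expmart a t \<omega> = exp (- (a\<^sup>2 * (t / (1 - t)) / 2)) * exp (a / (1 - t) * X t \<omega>)"
  by (simp add: expmart_def flip: exp_add)

lemma expmart_integral: assumes "0 \<le> t" "t < 1"
  shows "has_bochner_integral M (expmart a t) 1"
proof -
  have "(a / p)\<^sup>2 * (t * p) / 2 = a\<^sup>2 * (t / p) / 2" if "p \<noteq> 0" for p
    using that by (simp add: power2_eq_square)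
  moreover have "t - t * t = t * (1 - t)" by (simp add: right_diff_distrib)
  ultimately have "(a / (1 - t))\<^sup>2 * (t - t * t) / 2 = a\<^sup>2 * (t / (1 - t)) / 2"
    using assms by (metis diff_gt_0_iff_gt less_irrefl)
  then have "exp (- (a\<^sup>2 * (t / (1 - t)) / 2)) * exp ((a / (1 - t))\<^sup>2 * (t - t * t) / 2) = 1"
    by (metis add.left_inverse exp_add exp_zero)
  moreover have "has_bochner_integral M (\<lambda>\<omega>. exp (a / (1 - t) * X t \<omega>)) (exp ((a / (1 - t))\<^sup>2 * (t - t * t) / 2))"
    using assms by (intro exp_X) auto
  ultimately show ?thesis
    unfolding expmart_eq[abs_def] by (metis has_bochner_integral_cmult)
qed

lemma expmart_measurable_F: "t \<in> {0..1} \<Longrightarrow> expmart a t \<in> borel_measurable (F t)"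
  using adapted[of t] unfolding expmart_def by measurable

text \<open>\<open>X t / (1 - t)\<close> is the sum of \<open>X s / (1 - s)\<close> and a multiple
  of the residual \<open>N\<close>. The integrand thus factors into an \<open>F s\<close>-measurable
  \<open>U\<close> and a function \<open>V\<close> of \<open>N\<close> with mean 1, and
  \<open>indep_past\<close> makes them independent.\<close>

lemma expmart_martingale:
  assumes "0 \<le> s" "s \<le> t" "t < 1" and A: "A \<in> sets (F s)"
  shows "expectation (\<lambda>\<omega>. expmart a t \<omega> * indicator A \<omega>) = expectation (\<lambda>\<omega>. expmart a s \<omega> * indicator A \<omega>)"
proof (cases "s = t")
  case False
  then have "s < t" using assms by simp
  define N where "N \<omega> = X t \<omega> - (1 - t) / (1 - s) * X s \<omega>" for \<omega>
  \<comment> \<open>Half of \<open>a^2\<close> times the increment of the clock t / (1 - t) from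
    \<open>s\<close> to \<open>t\<close>.\<close>
  define w where "w = a\<^sup>2 * ((t - s) / ((1 - s) * (1 - t))) / 2"
  define U where "U \<omega> = expmart a s \<omega> * indicator A \<omega>" for \<omega>
  define V where "V \<omega> = exp (- w) * exp (a / (1 - t) * N \<omega>)" for \<omega>
  have s: "s \<in> {0..1}" and AM: "A \<in> sets M" using assms sets_F_subset[of s] by auto
  have split: "expmart a t \<omega> * indicator A \<omega> = U \<omega> * V \<omega>" for \<omega>
  proof -
    have "a * (X t \<omega> / (1 - t)) - a\<^sup>2 * (t / (1 - t)) / 2
        = (a * (X s \<omega> / (1 - s)) - a\<^sup>2 * (s / (1 - s)) / 2) + (- w + a / (1 - t) * N \<omega>)"
    proof -
      have "a / (1 - t) * N \<omega> = a * (X t \<omega> / (1 - t)) - a * (X s \<omega> / (1 - s))"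
        using assms by (simp add: N_def field_simps)
      moreover have "t / (1 - t) - s / (1 - s) = (t - s) / ((1 - s) * (1 - t))"
        using assms by (simp add: field_simps)
      then have "w = a\<^sup>2 * (t / (1 - t)) / 2 - a\<^sup>2 * (s / (1 - s)) / 2"
        unfolding w_def by (metis (no_types) diff_divide_distrib right_diff_distrib)
      ultimately show ?thesis by simp
    qed
    then have "expmart a t \<omega> = expmart a s \<omega> * V \<omega>"
      unfolding V_def expmart_def by (simp only: exp_add)
    then show ?thesis by (simp add: U_def)
  qed
  have "(a / p)\<^sup>2 * (r * p / q) / 2 = a\<^sup>2 * (r / (q * p)) / 2" if "p \<noteq> 0" for p q r
    using that by (simp add: power2_eq_square mult_ac)
  then have "(a / (1 - t))\<^sup>2 * ((t - s) * (1 - t) / (1 - s)) / 2 = w"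
    using assms unfolding w_def by (metis diff_gt_0_iff_gt less_irrefl)
  then have V: "has_bochner_integral M V 1"
    using has_bochner_integral_cmult[OF exp_residual[OF assms(1) \<open>s < t\<close> assms(3), of "a / (1 - t)"], of "exp (- w)"]
    by (simp add: V_def[abs_def] N_def[abs_def] flip: exp_add)
  have U: "integrable M U"
    unfolding U_def using expmart_integral[of s a] assms AM
    by (intro integrable_real_mult_indicator) (auto simp: has_bochner_integral_iff)
  have UF: "U \<in> borel_measurable (F s)"
    unfolding U_def using expmart_measurable_F[OF s] A by measurable
  have NM: "N \<in> borel_measurable M"
    unfolding N_def[abs_def] using measurable_X[of s] measurable_X[of t] assms by simp
  have "indep_var borel U borel V"
    unfolding indep_var_eq
  proof (intro conjI)
    show "U \<in> borel_measurable M" "V \<in> borel_measurable M" using U V by (auto simp: has_bochner_integral_iff)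
    have Vm: "V \<in> borel_measurable (vimage_algebra (space M) N borel)"
      unfolding V_def[abs_def] using measurable_vimage_algebra1[of N "space M" borel] by measurable
    have "indep_set (sets (F s)) (sets (vimage_algebra (space M) N borel))"
      using indep_past[of s t] assms unfolding N_def[abs_def] by auto
    moreover have "sigma_sets (space M) {U -` A \<inter> space M |A. A \<in> sets borel} \<subseteq> sets (F s)"
      using measurable_sets[OF UF] sets.sigma_sets_subset[of "{U -` A \<inter> space M |A. A \<in> sets borel}" "F s"]
      unfolding space_F by blast
    moreover have "sigma_sets (space M) {V -` A \<inter> space M |A. A \<in> sets borel} \<subseteq> sets (vimage_algebra (space M) N borel)"
      using measurable_sets[OF Vm]
        sets.sigma_sets_subset[of "{V -` A \<inter> space M |A. A \<in> sets borel}" "vimage_algebra (space M) N borel"]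
      unfolding space_vimage_algebra by blast
    ultimately show "indep_set (sigma_sets (space M) {U -` A \<inter> space M |A. A \<in> sets borel})
        (sigma_sets (space M) {V -` A \<inter> space M |A. A \<in> sets borel})"
      unfolding indep_sets2_eq by blast
  qed
  then have "expectation (\<lambda>\<omega>. U \<omega> * V \<omega>) = expectation U * expectation V"
    by (rule indep_var_lebesgue_integral) (use U V in \<open>auto simp: has_bochner_integral_iff\<close>)
  then show ?thesis
    unfolding split U_def[symmetric] using V by (simp add: has_bochner_integral_iff)
qed simp

text \<open>On each \<open>A k\<close> the value at \<open>t k\<close> may be exchanged for the
  value at the common later time \<open>T\<close> without changing the expectation; the pieces then
  add up to \<open>expmart a T\<close>, of mean 1.\<close>

lemma expmart_discrete_stopping:
  assumes "finite I" and I: "\<And>k. k \<in> I \<Longrightarrow> 0 \<le> t k \<and> t k \<le> T" "T < 1"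
    and A: "\<And>k. k \<in> I \<Longrightarrow> A k \<in> sets (F (t k))" "disjoint_family_on A I" "(\<Union>k\<in>I. A k) = space M"
    and S: "\<And>k \<omega>. k \<in> I \<Longrightarrow> \<omega> \<in> A k \<Longrightarrow> S \<omega> = t k"
  shows "has_bochner_integral M (\<lambda>\<omega>. expmart a (S \<omega>) \<omega>) 1"
proof -
  have AM: "A k \<in> sets M" if "k \<in> I" for k
    using A(1)[OF that] I(1)[OF that] I(2) sets_F_subset[of "t k"] by auto
  have ind: "(\<Sum>k\<in>I. h k * indicator (A k) \<omega>) = h j" if "j \<in> I" "\<omega> \<in> A j" for h :: "_ \<Rightarrow> real" and j \<omega>
  proof -
    have "(\<Sum>k\<in>I. h k * indicator (A k) \<omega>) = (\<Sum>k\<in>I. if k = j then h j else 0)"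
      using A(2) that by (intro sum.cong) (auto simp: disjoint_family_on_def indicator_def)
    then show ?thesis using \<open>finite I\<close> that by simp
  qed
  have t: "0 \<le> t k" "t k < 1" if "k \<in> I" for k using I(1)[OF that] I(2) by auto
  have eq: "(\<Sum>k\<in>I. expmart a (t k) \<omega> * indicator (A k) \<omega>) = expmart a (S \<omega>) \<omega>"
    "(\<Sum>k\<in>I. expmart a T \<omega> * indicator (A k) \<omega>) = expmart a T \<omega>" if "\<omega> \<in> space M" for \<omega>
  proof -
    obtain j where "j \<in> I" "\<omega> \<in> A j" using A(3) \<open>\<omega> \<in> space M\<close> by blast
    then show "(\<Sum>k\<in>I. expmart a (t k) \<omega> * indicator (A k) \<omega>) = expmart a (S \<omega>) \<omega>"
      "(\<Sum>k\<in>I. expmart a T \<omega> * indicator (A k) \<omega>) = expmart a T \<omega>"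
      using ind[of j \<omega> "\<lambda>k. expmart a (t k) \<omega>"] ind[of j \<omega> "\<lambda>k. expmart a T \<omega>"] S by auto
  qed
  have int: "integrable M (\<lambda>\<omega>. expmart a (t k) \<omega> * indicator (A k) \<omega>)" if "k \<in> I" for k
    using AM t expmart_integral that
    by (intro integrable_real_mult_indicator) (auto simp: has_bochner_integral_iff)
  have "I \<noteq> {}" using A(3) not_empty by auto
  then have T: "0 \<le> T" using I(1) by (meson all_not_in_conv order_trans)
  have intT: "integrable M (\<lambda>\<omega>. expmart a T \<omega> * indicator (A k) \<omega>)" if "k \<in> I" for k
    using AM T I(2) expmart_integral that
    by (intro integrable_real_mult_indicator) (auto simp: has_bochner_integral_iff)
  have "integrable M (\<lambda>\<omega>. \<Sum>k\<in>I. expmart a (t k) \<omega> * indicator (A k) \<omega>)"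
    using int by simp
  moreover have "expectation (\<lambda>\<omega>. \<Sum>k\<in>I. expmart a (t k) \<omega> * indicator (A k) \<omega>) = 1"
  proof -
    have "expectation (\<lambda>\<omega>. \<Sum>k\<in>I. expmart a (t k) \<omega> * indicator (A k) \<omega>)
        = (\<Sum>k\<in>I. expectation (\<lambda>\<omega>. expmart a T \<omega> * indicator (A k) \<omega>))"
      using int expmart_martingale[OF _ _ I(2) A(1)] I(1) by simp
    also have "\<dots> = expectation (\<lambda>\<omega>. \<Sum>k\<in>I. expmart a T \<omega> * indicator (A k) \<omega>)"
      using intT by simp
    also have "\<dots> = expectation (expmart a T)"
      using eq(2) by (intro Bochner_Integration.integral_cong) auto
    finally show ?thesis using expmart_integral[OF T I(2), of a] by (simp add: has_bochner_integral_iff)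
  qed
  ultimately have "has_bochner_integral M (\<lambda>\<omega>. \<Sum>k\<in>I. expmart a (t k) \<omega> * indicator (A k) \<omega>) 1"
    by (simp add: has_bochner_integral_iff)
  then show ?thesis
    using eq(1) by (subst has_bochner_integral_cong[OF refl _ refl]) auto
qed

section \<open>Stopping times approximated on a finite grid\<close>

text \<open>Rounds \<rho> up to the grid of mesh \<open>T / Suc n\<close>, capped at
  \<open>T\<close>. Rounding up makes the event of stopping at a grid time known at that
  time.\<close>

definition grid_stop :: "('a \<Rightarrow> real) \<Rightarrow> real \<Rightarrow> nat \<Rightarrow> 'a \<Rightarrow> real" where
  "grid_stop \<rho> T n \<omega> = T * real (min (Suc n) (nat \<lceil>\<rho> \<omega> * Suc n / T\<rceil>)) / Suc n"

context
  fixes \<rho> :: "'a \<Rightarrow> real" and T :: real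
  assumes \<rho>: "\<And>\<omega>. \<omega> \<in> space M \<Longrightarrow> 0 \<le> \<rho> \<omega>"
    and stop: "\<And>t. 0 \<le> t \<Longrightarrow> t < 1 \<Longrightarrow> {\<omega> \<in> space M. \<rho> \<omega> \<le> t} \<in> sets (F t)"
    and T: "0 < T" "T < 1"
begin

lemma grid_stop_bounds: "0 \<le> grid_stop \<rho> T n \<omega>" "grid_stop \<rho> T n \<omega> \<le> T"
proof -
  have "real (min (Suc n) k) / Suc n \<le> 1" for k by simp
  then have "T * (real (min (Suc n) (nat \<lceil>\<rho> \<omega> * Suc n / T\<rceil>)) / Suc n) \<le> T * 1"
    using T by (intro mult_left_mono) auto
  then show "grid_stop \<rho> T n \<omega> \<le> T" by (simp add: grid_stop_def)
qed (use T in \<open>simp add: grid_stop_def\<close>)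

text \<open>Rounding up overshoots \<open>min (\<rho> \<omega>) T\<close> by at most the
  mesh.\<close>

lemma grid_stop_tendsto:
  assumes "\<omega> \<in> space M"
  shows "(\<lambda>n. grid_stop \<rho> T n \<omega>) \<longlonglongrightarrow> min (\<rho> \<omega>) T"
proof (rule tendsto_sandwich)
  define x where "x n = \<rho> \<omega> * real (Suc n) / T" for n
  have x: "0 \<le> x n" for n using \<rho>[OF assms] T by (simp add: x_def)
  have *: "grid_stop \<rho> T n \<omega> = T / Suc n * min (real (Suc n)) (real (nat \<lceil>x n\<rceil>))" for n
    unfolding grid_stop_def x_def by (simp add: of_nat_min)
  have **: "min (\<rho> \<omega>) T = T / Suc n * min (real (Suc n)) (x n)" for n
  proof -
    have "T / Suc n * real (Suc n) = T" "T / Suc n * x n = \<rho> \<omega>" using T by (auto simp: x_def)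
    then show ?thesis using T unfolding min_mult_distrib_left by (simp add: min.commute)
  qed
  have "x n \<le> real (nat \<lceil>x n\<rceil>)" "real (nat \<lceil>x n\<rceil>) \<le> x n + 1" for n
    using x[of n] ceiling_correct[of "x n"] by (auto simp: of_nat_ceiling)
  then have 1: "min (\<rho> \<omega>) T \<le> grid_stop \<rho> T n \<omega>" for n
    unfolding * **[of n] using T by (intro mult_left_mono) (auto simp: min_def intro: order_trans)
  have "min (real (Suc n)) (real (nat \<lceil>x n\<rceil>)) \<le> min (real (Suc n)) (x n) + 1" for n
    using \<open>real (nat \<lceil>x n\<rceil>) \<le> x n + 1\<close> by (auto simp: min_def)
  then have 2: "grid_stop \<rho> T n \<omega> \<le> min (\<rho> \<omega>) T + T / Suc n" for n
  proof -
    have "grid_stop \<rho> T n \<omega> \<le> T / Suc n * (min (real (Suc n)) (x n) + 1)"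
      unfolding * using T \<open>min (real (Suc n)) (real (nat \<lceil>x n\<rceil>)) \<le> min (real (Suc n)) (x n) + 1\<close>
      by (intro mult_left_mono) auto
    then show ?thesis unfolding **[of n] by (simp add: distrib_left)
  qed
  show "\<forall>\<^sub>F n in sequentially. min (\<rho> \<omega>) T \<le> grid_stop \<rho> T n \<omega>"
    "\<forall>\<^sub>F n in sequentially. grid_stop \<rho> T n \<omega> \<le> min (\<rho> \<omega>) T + T / Suc n"
    using 1 2 by auto
  have "(\<lambda>n. min (\<rho> \<omega>) T + T * (1 / real (Suc n))) \<longlonglongrightarrow> min (\<rho> \<omega>) T + T * 0"
    by (intro tendsto_intros LIMSEQ_Suc[OF lim_inverse_n'])
  then show "(\<lambda>n. min (\<rho> \<omega>) T + T / real (Suc n)) \<longlonglongrightarrow> min (\<rho> \<omega>) T" by simp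
qed simp

lemma grid_stop_partition:
  obtains A where "\<And>k. k \<in> {..Suc n} \<Longrightarrow> A k \<in> sets (F (T * k / Suc n))"
    "disjoint_family_on A {..Suc n}" "(\<Union>k\<in>{..Suc n}. A k) = space M"
    "\<And>k \<omega>. k \<in> {..Suc n} \<Longrightarrow> \<omega> \<in> A k \<Longrightarrow> grid_stop \<rho> T n \<omega> = T * k / Suc n"
proof -
  define K where "K \<omega> = min (Suc n) (nat \<lceil>\<rho> \<omega> * Suc n / T\<rceil>)" for \<omega>
  define A where "A k = {\<omega> \<in> space M. K \<omega> = k}" for k
  have le: "{\<omega> \<in> space M. K \<omega> \<le> k} \<in> sets (F (T * k / Suc n))" if k: "k \<le> Suc n" for k
  proof (cases "k = Suc n")
    case True
    then have "{\<omega> \<in> space M. K \<omega> \<le> k} = space (F (T * k / Suc n))" by (auto simp: K_def space_F)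
    then show ?thesis by simp
  next
    \<comment> \<open>Below the top index the cap is inactive and the event is
      \<open>\<rho> \<omega> \<le> T * k / Suc n\<close>; this time is less than 1, as
      \<open>stop\<close> requires.\<close>
    case False
    then have "k < Suc n" using k by simp
    have "K \<omega> \<le> k \<longleftrightarrow> \<rho> \<omega> \<le> T * k / Suc n" for \<omega>
    proof -
      have "K \<omega> \<le> k \<longleftrightarrow> \<rho> \<omega> * Suc n / T \<le> k"
        using \<open>k < Suc n\<close> unfolding K_def min_le_iff_disj nat_le_iff ceiling_le_iff by simp
      also have "\<dots> \<longleftrightarrow> \<rho> \<omega> \<le> T * k / Suc n"
        using T by (simp add: field_simps)
      finally show ?thesis .
    qed
    moreover have "T * k / Suc n < 1"
    proof -
      have "T * k \<le> T * Suc n" using \<open>k < Suc n\<close> T by (intro mult_left_mono) auto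
      also have "\<dots> < 1 * real (Suc n)" using T by (intro mult_strict_right_mono) auto
      finally show ?thesis by simp
    qed
    ultimately show ?thesis using stop[of "T * k / Suc n"] T by simp
  qed
  show thesis
  proof (rule that[of A])
    fix k assume k: "k \<in> {..Suc n}"
    show "A k \<in> sets (F (T * k / Suc n))"
    proof (cases k)
      case 0
      then have "A k = {\<omega> \<in> space M. K \<omega> \<le> k}" by (auto simp: A_def)
      then show ?thesis using le[of k] 0 by simp
    next
      case (Suc j)
      then have "A k = {\<omega> \<in> space M. K \<omega> \<le> k} - {\<omega> \<in> space M. K \<omega> \<le> j}" by (auto simp: A_def)
      moreover have "sets (F (T * j / Suc n)) \<subseteq> sets (F (T * k / Suc n))"
        using T Suc by (intro sets_F_mono) (auto intro!: divide_right_mono mult_left_mono)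
      moreover have "j \<le> Suc n" using k Suc by simp
      ultimately show ?thesis using le[of k] le[of j] k by auto
    qed
  next
    fix k \<omega> assume "\<omega> \<in> A k" then show "grid_stop \<rho> T n \<omega> = T * k / Suc n"
      by (auto simp: A_def K_def grid_stop_def)
  next
    show "(\<Union>k\<in>{..Suc n}. A k) = space M" by (auto simp: A_def K_def)
  qed (auto simp: A_def disjoint_family_on_def)
qed

lemma expmart_grid_stop: "has_bochner_integral M (\<lambda>\<omega>. expmart a (grid_stop \<rho> T n \<omega>) \<omega>) 1"
proof -
  obtain A where A: "\<And>k. k \<in> {..Suc n} \<Longrightarrow> A k \<in> sets (F (T * k / Suc n))"
    "disjoint_family_on A {..Suc n}" "(\<Union>k\<in>{..Suc n}. A k) = space M"
    "\<And>k \<omega>. k \<in> {..Suc n} \<Longrightarrow> \<omega> \<in> A k \<Longrightarrow> grid_stop \<rho> T n \<omega> = T * k / Suc n"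
    by (rule grid_stop_partition[of n]) blast
  have "T * real k / Suc n \<le> T" if "k \<le> Suc n" for k
    using T that by (simp add: divide_le_eq)
  with T show ?thesis
    by (intro expmart_discrete_stopping[where I="{..Suc n}" and t="\<lambda>k. T * real k / Suc n" and T=T, OF _ _ _ A]) auto
qed

lemma X_tendsto:
  assumes "\<omega> \<in> space M"
  shows "(\<lambda>n. X (grid_stop \<rho> T n \<omega>) \<omega>) \<longlonglongrightarrow> X (min (\<rho> \<omega>) T) \<omega>"
proof (rule continuous_on_tendsto_compose[OF continuous_paths[OF assms] grid_stop_tendsto[OF assms]])
  show "min (\<rho> \<omega>) T \<in> {0..1}" using \<rho>[OF assms] T by auto
  show "\<forall>\<^sub>F n in sequentially. grid_stop \<rho> T n \<omega> \<in> {0..1}"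
    using grid_stop_bounds T by (intro always_eventually allI) (force intro: order_trans[of _ T])
qed

lemma measurable_grid_stop: "grid_stop \<rho> T n \<in> borel_measurable M"
  and measurable_X_grid_stop: "(\<lambda>\<omega>. X (grid_stop \<rho> T n \<omega>) \<omega>) \<in> borel_measurable M"
proof -
  obtain A where A: "\<And>k. k \<in> {..Suc n} \<Longrightarrow> A k \<in> sets (F (T * k / Suc n))"
    "disjoint_family_on A {..Suc n}" "(\<Union>k\<in>{..Suc n}. A k) = space M"
    "\<And>k \<omega>. k \<in> {..Suc n} \<Longrightarrow> \<omega> \<in> A k \<Longrightarrow> grid_stop \<rho> T n \<omega> = T * k / Suc n"
    by (rule grid_stop_partition[of n]) blast
  have t: "T * real k / Suc n \<in> {0..1}" if "k \<in> {..Suc n}" for k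
  proof -
    have "T * real k \<le> 1 * real (Suc n)" using T that by (intro mult_mono) auto
    then show ?thesis using T by (simp add: divide_le_eq)
  qed
  have AM: "A k \<in> sets M" if "k \<in> {..Suc n}" for k
    using A(1)[OF that] sets_F_subset[OF t[OF that]] by auto
  \<comment> \<open>General in \<open>h\<close> because it is used twice: for the grid time itself
    and for \<open>X\<close> at that time.\<close>
  have meas: "(\<lambda>\<omega>. h (grid_stop \<rho> T n \<omega>) \<omega>) \<in> borel_measurable M"
    if h: "\<And>t. t \<in> {0..1} \<Longrightarrow> h t \<in> borel_measurable M" for h :: "real \<Rightarrow> 'a \<Rightarrow> real"
  proof -
    have "h (grid_stop \<rho> T n \<omega>) \<omega> = (\<Sum>k\<in>{..Suc n}. h (T * real k / Suc n) \<omega> * indicator (A k) \<omega>)"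
      if "\<omega> \<in> space M" for \<omega>
    proof -
      obtain j where j: "j \<in> {..Suc n}" "\<omega> \<in> A j" using A(3) \<open>\<omega> \<in> space M\<close> by blast
      have "(\<Sum>k\<in>{..Suc n}. h (T * real k / Suc n) \<omega> * indicator (A k) \<omega>)
          = (\<Sum>k\<in>{..Suc n}. if k = j then h (T * real j / Suc n) \<omega> else 0)"
        using A(2) j by (intro sum.cong) (auto simp: disjoint_family_on_def indicator_def)
      then show ?thesis using j A(4)[OF j] by (simp del: sum.atMost_Suc of_nat_Suc)
    qed
    moreover have "(\<lambda>\<omega>. \<Sum>k\<in>{..Suc n}. h (T * real k / Suc n) \<omega> * indicator (A k) \<omega>) \<in> borel_measurable M"
      using h[OF t] AM by (intro borel_measurable_sum borel_measurable_times borel_measurable_indicator) auto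
    ultimately show ?thesis by (subst measurable_cong) auto
  qed
  show "grid_stop \<rho> T n \<in> borel_measurable M" using meas[of "\<lambda>t _. t"] by simp
  show "(\<lambda>\<omega>. X (grid_stop \<rho> T n \<omega>) \<omega>) \<in> borel_measurable M" using meas[of X] measurable_X by simp
qed

lemma measurable_X_stopped: "(\<lambda>\<omega>. X (min (\<rho> \<omega>) T) \<omega>) \<in> borel_measurable M"
  by (rule borel_measurable_LIMSEQ_real[OF X_tendsto measurable_X_grid_stop])

lemma measurable_min_stop: "(\<lambda>\<omega>. min (\<rho> \<omega>) T) \<in> borel_measurable M"
  by (rule borel_measurable_LIMSEQ_real[OF grid_stop_tendsto measurable_grid_stop])

text \<open>Squaring doubles the parameter up to a factor depending on time alone. That factor is
  bounded on \<open>[0, T]\<close> because \<open>T < 1\<close>, and so the second moments along the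
  grid are bounded uniformly.\<close>

lemma expmart_square:
  assumes "0 \<le> t" "t \<le> T"
  shows "(expmart a t \<omega>)\<^sup>2 \<le> exp (a\<^sup>2 * (T / (1 - T))) * expmart (2 * a) t \<omega>"
proof -
  have "(expmart a t \<omega>)\<^sup>2 = exp (a\<^sup>2 * (t / (1 - t))) * expmart (2 * a) t \<omega>"
  proof -
    have "2 * (a * x - a\<^sup>2 * u / 2) = a\<^sup>2 * u + (2 * a * x - (2 * a)\<^sup>2 * u / 2)" for x u
      by (simp add: power2_eq_square algebra_simps)
    then show ?thesis unfolding expmart_def exp_add[symmetric] exp_double[symmetric] by presburger
  qed
  also have "t / (1 - t) \<le> T / (1 - T)" using assms T by (intro frac_le) auto
  then have "exp (a\<^sup>2 * (t / (1 - t))) * expmart (2 * a) t \<omega> \<le> exp (a\<^sup>2 * (T / (1 - T))) * expmart (2 * a) t \<omega>"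
    unfolding expmart_def by (intro mult_right_mono) (auto intro!: mult_left_mono simp del: times_divide_eq_right)
  finally show ?thesis .
qed

lemma expmart_optional_stopping:
  "integrable M (\<lambda>\<omega>. expmart a (min (\<rho> \<omega>) T) \<omega>) \<and> expectation (\<lambda>\<omega>. expmart a (min (\<rho> \<omega>) T) \<omega>) = 1"
proof (rule integral_limit_L2_bounded)
  let ?f = "\<lambda>n \<omega>. expmart a (grid_stop \<rho> T n \<omega>) \<omega>"
  let ?C = "exp (a\<^sup>2 * (T / (1 - T)))"
  fix n
  show int: "integrable M (?f n)" and "expectation (?f n) = 1"
    using expmart_grid_stop[of a n] by (auto simp: has_bochner_integral_iff)
  have le: "(?f n \<omega>)\<^sup>2 \<le> ?C * expmart (2 * a) (grid_stop \<rho> T n \<omega>) \<omega>" for \<omega>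
    by (intro expmart_square grid_stop_bounds)
  have int': "integrable M (\<lambda>\<omega>. ?C * expmart (2 * a) (grid_stop \<rho> T n \<omega>) \<omega>)"
    using expmart_grid_stop[of "2 * a" n] by (simp add: has_bochner_integral_iff)
  show int2: "integrable M (\<lambda>\<omega>. (?f n \<omega>)\<^sup>2)"
    using int le by (intro Bochner_Integration.integrable_bound[OF int']) (auto simp: expmart_def)
  have "expectation (\<lambda>\<omega>. (?f n \<omega>)\<^sup>2) \<le> expectation (\<lambda>\<omega>. ?C * expmart (2 * a) (grid_stop \<rho> T n \<omega>) \<omega>)"
    using le by (intro integral_mono int2 int') auto
  then show "expectation (\<lambda>\<omega>. (?f n \<omega>)\<^sup>2) \<le> ?C"
    using expmart_grid_stop[of "2 * a" n] by (simp add: has_bochner_integral_iff)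
  fix \<omega>
  show "0 \<le> ?f n \<omega>" by (simp add: expmart_def)
next
  fix \<omega> assume \<omega>: "\<omega> \<in> space M"
  have "1 - min (\<rho> \<omega>) T \<noteq> 0" using T by auto
  then show "(\<lambda>n. expmart a (grid_stop \<rho> T n \<omega>) \<omega>) \<longlonglongrightarrow> expmart a (min (\<rho> \<omega>) T) \<omega>"
    unfolding expmart_def by (intro tendsto_intros X_tendsto grid_stop_tendsto \<omega>) auto
qed

end

end

section \<open>Hitting the square-root boundaries\<close>

text \<open>The value is \<open>sqrt (pi / 2)\<close>; it enters the hitting equations as a positive
  constant and cancels in \<open>hit_values\<close>.\<close>

definition gauss_half :: real where
  "gauss_half = lim (\<lambda>n. gauss_int (real n))"

lemma gauss_int_at_top: "(gauss_int \<longlongrightarrow> gauss_half) at_top"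
proof (rule tendsto_at_topI_sequentially_real)
  show "mono gauss_int" by (simp add: mono_def gauss_int_mono)
  have "convergent (\<lambda>n. gauss_int (real n))"
    using gauss_int_le by (intro Bseq_mono_convergent BseqI'[of _ 2])
      (auto simp: gauss_int_mono abs_of_nonneg gauss_int_mono[of 0, simplified])
  then show "(\<lambda>n. gauss_int (real n)) \<longlonglongrightarrow> gauss_half"
    by (simp add: gauss_half_def convergent_LIMSEQ_iff)
qed

lemma gauss_int_less_half: "gauss_int x < gauss_half"
proof -
  have "eventually (\<lambda>y. gauss_int (x + 1) \<le> gauss_int y) at_top"
    using eventually_ge_at_top[of "x + 1"] by eventually_elim (rule gauss_int_mono)
  then have "gauss_int (x + 1) \<le> gauss_half"
    by (intro tendsto_lowerbound[OF gauss_int_at_top]) auto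
  with gauss_int_strict_mono[of x "x + 1"] show ?thesis by simp
qed

lemma gauss_int_minus: "gauss_int (- x) = - gauss_int x"
proof -
  have "((\<lambda>x. gauss_int x + gauss_int (- x)) has_real_derivative 0) (at z)" for z
    using has_real_derivative_gauss_int[of "- z"]
    by (auto intro!: derivative_eq_intros has_real_derivative_gauss_int DERIV_chain2[where f=gauss_int])
  then have "gauss_int x + gauss_int (- x) = gauss_int 0 + gauss_int (- 0)"
    by (intro DERIV_isconst_all[where f="\<lambda>x. gauss_int x + gauss_int (- x)"]) blast
  then show ?thesis by simp
qed

definition mills :: "real \<Rightarrow> real" where
  "mills y = exp (y\<^sup>2 / 2) * (gauss_half + gauss_int y)"

text \<open>\<open>mills\<close> and its reflection span the solutions of \<open>f'' y = y * f' y + f y\<close>, the equation making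
  \<open>sqrt (1 - t) * f (X\<^sub>t / sqrt (1 - t))\<close> a local martingale.\<close>

lemma mills_0: "mills 0 = gauss_half"
  by (simp add: mills_def)

lemma mills_nonneg: "0 \<le> mills y"
  using gauss_int_less_half[of "- y"] by (simp add: mills_def gauss_int_minus)

lemma isCont_mills: "isCont mills y"
  unfolding mills_def[abs_def]
  by (intro continuous_intros DERIV_isCont[OF has_real_derivative_gauss_int]) auto

lemma mills_measurable [measurable]: "mills \<in> borel_measurable borel"
  by (intro borel_measurable_continuous_onI continuous_at_imp_continuous_on ballI isCont_mills)

lemma mills_bound: "\<bar>y\<bar> \<le> C \<Longrightarrow> mills y \<le> exp (C\<^sup>2 / 2) * (gauss_half + gauss_int C)"
proof -
  assume y: "\<bar>y\<bar> \<le> C"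
  then have "y\<^sup>2 \<le> C\<^sup>2" by (metis abs_le_square_iff abs_ge_self order_trans)
  then show ?thesis unfolding mills_def
    using y gauss_int_mono[of y C] gauss_int_less_half[of "- C"] gauss_int_less_half[of "- y"]
    by (intro mult_mono) (auto simp: gauss_int_minus)
qed

text \<open>Since \<open>y * r - r^2 / 2 = y^2 / 2 - (r - y)^2 / 2\<close>, an antiderivative is
  \<open>exp (y^2 / 2) * gauss_int (r - y)\<close>; its value at \<open>r = 0\<close> contributes
  \<open>gauss_int y\<close> by oddness.\<close>

lemma nn_integral_mills:
  "(\<integral>\<^sup>+r. ennreal (exp (y * r - r\<^sup>2 / 2)) * indicator {0..} r \<partial>lborel) = ennreal (mills y)"
proof -
  have eq: "exp (y * r - r\<^sup>2 / 2) = exp (y\<^sup>2 / 2) * exp (- (r - y)\<^sup>2 / 2)" for r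
    by (simp add: power2_eq_square field_simps flip: exp_add)
  have "((\<lambda>r. exp (y\<^sup>2 / 2) * gauss_int (r - y)) \<longlongrightarrow> exp (y\<^sup>2 / 2) * gauss_half) at_top"
    by (intro tendsto_intros filterlim_compose[OF gauss_int_at_top])
      (auto intro!: filterlim_tendsto_add_at_top[of "\<lambda>_. - y" "- y", simplified] filterlim_ident)
  then have "(\<integral>\<^sup>+r. ennreal (exp (y * r - r\<^sup>2 / 2)) * indicator {0..} r \<partial>lborel)
      = ennreal (exp (y\<^sup>2 / 2) * gauss_half - exp (y\<^sup>2 / 2) * gauss_int (0 - y))"
    unfolding eq
    by (intro nn_integral_FTC_atLeast)
      (auto intro!: derivative_eq_intros DERIV_chain2[where f=gauss_int] has_real_derivative_gauss_int)
  then show ?thesis by (simp add: mills_def gauss_int_minus algebra_simps)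
qed

text \<open>The weight \<open>exp (- a^2 / 2)\<close> raises the clock t / (1 - t) to 1 + t / (1 -
  t) = 1 / (1 - t), so the substitution \<open>a = sqrt (1 - t) * r\<close> reduces the integral to
  \<open>nn_integral_mills\<close>.\<close>

lemma nn_integral_expmart:
  assumes "t < 1"
  shows "(\<integral>\<^sup>+a. ennreal (exp (- a\<^sup>2 / 2) * exp (a * (x / (1 - t)) - a\<^sup>2 * (t / (1 - t)) / 2)) * indicator {0..} a \<partial>lborel)
    = ennreal (sqrt (1 - t) * mills (x / sqrt (1 - t)))"
proof -
  define p where "p = sqrt (1 - t)"
  have p: "0 < p" "p\<^sup>2 = 1 - t" using assms by (auto simp: p_def)
  have eq: "ennreal (exp (- (p * r)\<^sup>2 / 2) * exp (p * r * (x / (1 - t)) - (p * r)\<^sup>2 * (t / (1 - t)) / 2)) * indicator {0..} (p * r)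
      = ennreal (exp (x / p * r - r\<^sup>2 / 2)) * indicator {0..} r" for r
  proof -
    have "(p * r)\<^sup>2 * (1 + t / (1 - t)) = r\<^sup>2"
      unfolding power_mult_distrib p(2) using assms by (simp add: field_simps)
    moreover have "p * r * (x / (1 - t)) = x / p * r"
      unfolding p(2)[symmetric] using p(1) by (simp add: power2_eq_square)
    moreover have "- w / 2 + (q - w * u / 2) = q - w * (1 + u) / 2" for w q u :: real
      by (simp add: field_simps)
    ultimately have "- (p * r)\<^sup>2 / 2 + (p * r * (x / (1 - t)) - (p * r)\<^sup>2 * (t / (1 - t)) / 2) = x / p * r - r\<^sup>2 / 2"
      by presburger
    moreover have "indicator {0..} (p * r) = (indicator {0..} r :: ennreal)"
      using p(1) by (simp add: indicator_def zero_le_mult_iff)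
    ultimately show ?thesis by (metis exp_add)
  qed
  have "(\<integral>\<^sup>+a. ennreal (exp (- a\<^sup>2 / 2) * exp (a * (x / (1 - t)) - a\<^sup>2 * (t / (1 - t)) / 2)) * indicator {0..} a \<partial>lborel)
      = ennreal \<bar>p\<bar> * (\<integral>\<^sup>+r. ennreal (exp (- (0 + p * r)\<^sup>2 / 2) * exp ((0 + p * r) * (x / (1 - t)) - (0 + p * r)\<^sup>2 * (t / (1 - t)) / 2)) * indicator {0..} (0 + p * r) \<partial>lborel)"
    using p(1) by (intro nn_integral_real_affine) auto
  also have "\<dots> = ennreal p * ennreal (mills (x / p))"
    unfolding add_0_left eq nn_integral_mills using p(1) by simp
  finally show ?thesis using p(1) mills_nonneg by (simp add: ennreal_mult p_def)
qed

section \<open>The stopped martingales built from \<open>mills\<close>\<close>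

context brownian_bridge
begin

context
  fixes \<rho> :: "'a \<Rightarrow> real"
  assumes \<rho>: "\<And>\<omega>. \<omega> \<in> space M \<Longrightarrow> 0 \<le> \<rho> \<omega> \<and> \<rho> \<omega> \<le> 1"
    and stop: "\<And>t. 0 \<le> t \<Longrightarrow> t < 1 \<Longrightarrow> {\<omega> \<in> space M. \<rho> \<omega> \<le> t} \<in> sets (F t)"
begin

text \<open>Fubini for a nonnegative integrand: for each parameter the stopped exponential
  martingale has mean 1, which leaves the integral of the weight, \<open>mills 0\<close>. The sign
  \<open>sg\<close> selects the half line of parameters, that is, \<open>mills\<close> or its
  reflection.\<close>

lemma nn_integral_mills_stopped:
  assumes T: "0 < T" "T < 1" and sg: "sg \<in> {1, -1}"
  shows "(\<integral>\<^sup>+\<omega>. ennreal (sqrt (1 - min (\<rho> \<omega>) T) * mills (sg * X (min (\<rho> \<omega>) T) \<omega> / sqrt (1 - min (\<rho> \<omega>) T))) \<partial>M)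
    = ennreal gauss_half"
proof -
  define S where "S \<omega> = min (\<rho> \<omega>) T" for \<omega>
  have S1: "S \<omega> < 1" for \<omega> using T by (simp add: S_def)
  have \<rho>0: "\<And>\<omega>. \<omega> \<in> space M \<Longrightarrow> 0 \<le> \<rho> \<omega>" using \<rho> by blast
  have [measurable]: "S \<in> borel_measurable M" "(\<lambda>\<omega>. X (S \<omega>) \<omega>) \<in> borel_measurable M"
    unfolding S_def using measurable_min_stop[OF \<rho>0 stop T] measurable_X_stopped[OF \<rho>0 stop T] by auto
  have sg2: "sg\<^sup>2 = 1" using sg by auto
  let ?f = "\<lambda>(\<omega>, a). ennreal (exp (- a\<^sup>2 / 2) * expmart (sg * a) (S \<omega>) \<omega>) * indicator {0..} a"
  interpret P: pair_sigma_finite M lborel ..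
  have [measurable]: "?f \<in> borel_measurable (M \<Otimes>\<^sub>M lborel)"
    unfolding expmart_def by measurable
  have 1: "ennreal (sqrt (1 - S \<omega>) * mills (sg * X (S \<omega>) \<omega> / sqrt (1 - S \<omega>))) = (\<integral>\<^sup>+a. ?f (\<omega>, a) \<partial>lborel)" for \<omega>
    using nn_integral_expmart[OF S1, of "sg * X (S \<omega>) \<omega>" \<omega>] by (simp add: expmart_def sg2 power_mult_distrib mult_ac)
  \<comment> \<open>The term \<open>0 * a\<close> brings the weight into the form of
    \<open>nn_integral_mills\<close> at \<open>y = 0\<close>.\<close>
  have 2: "(\<integral>\<^sup>+\<omega>. ?f (\<omega>, a) \<partial>M) = ennreal (exp (0 * a - a\<^sup>2 / 2)) * indicator {0..} a" for a
  proof -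
    have "(\<integral>\<^sup>+\<omega>. ennreal (expmart (sg * a) (S \<omega>) \<omega>) \<partial>M) = 1"
      using expmart_optional_stopping[OF \<rho>0 stop T, of "sg * a"] unfolding S_def
      by (subst nn_integral_eq_integral) (auto simp: expmart_def)
    then show ?thesis
      by (simp add: ennreal_mult nn_integral_cmult nn_integral_multc expmart_def)
  qed
  have "(\<integral>\<^sup>+\<omega>. ennreal (sqrt (1 - S \<omega>) * mills (sg * X (S \<omega>) \<omega> / sqrt (1 - S \<omega>))) \<partial>M)
      = (\<integral>\<^sup>+a. \<integral>\<^sup>+\<omega>. ?f (\<omega>, a) \<partial>M \<partial>lborel)"
    unfolding 1 by (rule P.Fubini[symmetric]) measurable
  also have "\<dots> = ennreal gauss_half"
    unfolding 2 nn_integral_mills mills_0 ..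
  finally show ?thesis by (simp add: S_def)
qed

text \<open>Up to \<rho> the argument of \<open>mills\<close> lies in \<open>[- C, C]\<close>, so
  the variables stopped at \<open>T n\<close> have a common bound and dominated convergence
  applies.\<close>

lemma integral_mills_stopped:
  assumes bound: "\<And>\<omega> t. \<omega> \<in> space M \<Longrightarrow> 0 \<le> t \<Longrightarrow> t < 1 \<Longrightarrow> t \<le> \<rho> \<omega> \<Longrightarrow> \<bar>X t \<omega>\<bar> \<le> C * sqrt (1 - t)"
    and sg: "sg \<in> {1, -1}"
  shows "(\<integral>\<omega>. (if \<rho> \<omega> < 1 then sqrt (1 - \<rho> \<omega>) * mills (sg * X (\<rho> \<omega>) \<omega> / sqrt (1 - \<rho> \<omega>)) else 0) \<partial>M) = gauss_half"
proof -
  \<comment> \<open>The summand 2 makes \<open>T 0\<close> positive, so that every cap lies strictly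
    between 0 and 1.\<close>
  define T where "T n = 1 - 1 / (real n + 2)" for n :: nat
  have T: "0 < T n" "T n < 1" for n by (auto simp: T_def)
  define S where "S n \<omega> = min (\<rho> \<omega>) (T n)" for n \<omega>
  define f where "f n \<omega> = sqrt (1 - S n \<omega>) * mills (sg * X (S n \<omega>) \<omega> / sqrt (1 - S n \<omega>))" for n \<omega>
  define g where "g \<omega> = (if \<rho> \<omega> < 1 then sqrt (1 - \<rho> \<omega>) * mills (sg * X (\<rho> \<omega>) \<omega> / sqrt (1 - \<rho> \<omega>)) else 0)" for \<omega>
  define G where "G = exp (C\<^sup>2 / 2) * (gauss_half + gauss_int C)"
  have G: "0 \<le> G" using mills_bound[of C "\<bar>C\<bar>"] gauss_int_less_half[of "- C"] by (simp add: G_def gauss_int_minus)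
  have T_lim: "T \<longlonglongrightarrow> 1"
    unfolding T_def by real_asymp
  have \<rho>0: "\<And>\<omega>. \<omega> \<in> space M \<Longrightarrow> 0 \<le> \<rho> \<omega>" using \<rho> by blast
  have S1: "S n \<omega> < 1" "S n \<omega> \<le> \<rho> \<omega>" for n \<omega> using T[of n] by (auto simp: S_def)
  have S0: "0 \<le> S n \<omega>" if "\<omega> \<in> space M" for n \<omega> using T[of n] \<rho>0[OF that] by (auto simp: S_def)
  have [measurable]: "S n \<in> borel_measurable M" "(\<lambda>\<omega>. X (S n \<omega>) \<omega>) \<in> borel_measurable M" for n
    unfolding S_def using measurable_min_stop[OF \<rho>0 stop T] measurable_X_stopped[OF \<rho>0 stop T] by auto
  have f_meas: "f n \<in> borel_measurable M" for n unfolding f_def by measurable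
  have f0: "0 \<le> f n \<omega>" for n \<omega> using S1[of n \<omega>] mills_nonneg by (simp add: f_def)
  have f_le: "f n \<omega> \<le> sqrt (1 - S n \<omega>) * G" if "\<omega> \<in> space M" for n \<omega>
  proof -
    have "\<bar>sg * X (S n \<omega>) \<omega> / sqrt (1 - S n \<omega>)\<bar> = \<bar>X (S n \<omega>) \<omega>\<bar> / sqrt (1 - S n \<omega>)"
      using sg S1[of n \<omega>] by auto
    also have "\<dots> \<le> C"
      using bound[OF that S0[OF that] S1] S1[of n \<omega>] by (simp add: divide_le_eq)
    finally show ?thesis unfolding f_def G_def
      using S1[of n \<omega>] by (intro mult_left_mono mills_bound) auto
  qed
  have f_le_G: "f n \<omega> \<le> G" if "\<omega> \<in> space M" for n \<omega>
  proof -
    have "sqrt (1 - S n \<omega>) * G \<le> 1 * G" using S0[OF that] G by (intro mult_right_mono) auto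
    with f_le[OF that, of n] show ?thesis by simp
  qed
  have lim: "(\<lambda>n. f n \<omega>) \<longlonglongrightarrow> g \<omega>" if \<omega>: "\<omega> \<in> space M" for \<omega>
  proof (cases "\<rho> \<omega> < 1")
    case True
    have "eventually (\<lambda>n. \<rho> \<omega> < T n) sequentially"
      using order_tendstoD(1)[OF T_lim True] .
    then have "eventually (\<lambda>n. f n \<omega> = g \<omega>) sequentially"
      by eventually_elim (use True in \<open>simp add: f_def g_def S_def min_def\<close>)
    then show ?thesis by (rule tendsto_eventually)
  next
    case False
    \<comment> \<open>No boundary is reached before time 1: \<open>mills\<close> stays bounded while
      \<open>sqrt (1 - T n)\<close> tends to 0, which explains the value 0 in the limit.\<close>
    then have "S n \<omega> = T n" for n using T[of n] by (simp add: S_def)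
    then have "f n \<omega> \<le> sqrt (1 - T n) * G" for n using f_le[OF \<omega>, of n] by simp
    moreover have "(\<lambda>n. sqrt (1 - T n) * G) \<longlonglongrightarrow> sqrt (1 - 1) * G"
      by (intro tendsto_intros T_lim)
    ultimately have "(\<lambda>n. f n \<omega>) \<longlonglongrightarrow> 0"
      using f0 by (intro tendsto_sandwich[of "\<lambda>_. 0" "\<lambda>n. f n \<omega>" _ "\<lambda>n. sqrt (1 - T n) * G"]) auto
    then show ?thesis using False by (simp add: g_def)
  qed
  have g_meas: "g \<in> borel_measurable M"
    by (rule borel_measurable_LIMSEQ_real[OF lim f_meas])
  have "(\<lambda>n. expectation (f n)) \<longlonglongrightarrow> expectation g"
    using f0 f_le_G lim f_meas g_meas
    by (intro integral_dominated_convergence[where w="\<lambda>_. G"]) (auto simp: abs_of_nonneg)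
  moreover have "expectation (f n) = gauss_half" for n
  proof -
    have "(\<integral>\<^sup>+\<omega>. ennreal (f n \<omega>) \<partial>M) = ennreal gauss_half"
      using nn_integral_mills_stopped[OF T sg] by (simp add: f_def S_def)
    then show ?thesis
      using f0 f_meas gauss_int_less_half[of 0] by (subst integral_eq_nn_integral) auto
  qed
  ultimately show ?thesis
    using LIMSEQ_unique[OF tendsto_const] by (force simp: g_def[abs_def])
qed

end

text \<open>Player 2 facing \<open>X\<close> is Player 1 facing \<open>- X\<close>, so results on
  \<open>tau_sq\<close> carry over to \<open>sigma_sq\<close>. For the independence, the reflected
  residual is a measurable function of the residual and generates no larger sigma-algebra.\<close>

lemma uminus_bridge: "brownian_bridge M F (\<lambda>t \<omega>. - X t \<omega>)"
proof unfold_locales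
  fix t :: real assume "t \<in> {0..1}"
  then show "(\<lambda>\<omega>. - X t \<omega>) \<in> borel_measurable (F t)" using adapted[of t] by simp
next
  fix \<omega> assume "\<omega> \<in> space M"
  then show "continuous_on {0..1} (\<lambda>t. - X t \<omega>)" "- X 0 \<omega> = 0" "- X 1 \<omega> = 0"
    using continuous_paths starts_at_0 ends_at_0 by (auto intro: continuous_on_minus)
next
  fix T :: "real set" and c assume "finite T" "T \<subseteq> {0..1}"
  then show "distr M borel (\<lambda>\<omega>. \<Sum>t\<in>T. c t * - X t \<omega>) =
      gaussian_law 0 (\<Sum>s\<in>T. \<Sum>t\<in>T. c s * c t * (min s t - s * t))"
    using gaussian[of T "\<lambda>t. - c t"] by simp
next
  fix s t :: real assume st: "0 \<le> s" "s \<le> t" "t \<le> 1" "s < 1"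
  let ?N = "\<lambda>\<omega>. X t \<omega> - (1 - t) / (1 - s) * X s \<omega>"
  have "(\<lambda>\<omega>. - ?N \<omega>) \<in> borel_measurable (vimage_algebra (space M) ?N borel)"
    using measurable_vimage_algebra1[of ?N "space M" borel] by measurable
  then have "sets (vimage_algebra (space M) (\<lambda>\<omega>. - ?N \<omega>) borel) \<subseteq> sets (vimage_algebra (space M) ?N borel)"
    by (intro sets_image_in_sets) auto
  moreover have eq: "(\<lambda>\<omega>. - X t \<omega> - (1 - t) / (1 - s) * - X s \<omega>) = (\<lambda>\<omega>. - ?N \<omega>)"
    by (simp add: fun_eq_iff)
  ultimately show "indep_set (sets (F s)) (sets (vimage_algebra (space M) (\<lambda>\<omega>. - X t \<omega> - (1 - t) / (1 - s) * - X s \<omega>) borel))"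
    using indep_past[OF st] unfolding indep_sets2_eq eq by blast
qed

section \<open>Hitting times of the square-root boundary\<close>

text \<open>The set \<open>H\<close> is closed by path continuity and contains 1, where both
  boundary and bridge vanish. So its infimum is attained.\<close>

lemma tau_props:
  assumes \<omega>: "\<omega> \<in> space M"
  shows tau_ge_0: "0 \<le> tau_sq X b \<omega>" and tau_le_1: "tau_sq X b \<omega> \<le> 1"
    and tau_hit_ge: "b * sqrt (1 - tau_sq X b \<omega>) \<le> X (tau_sq X b \<omega>) \<omega>"
    and before_tau: "\<And>t. 0 \<le> t \<Longrightarrow> t < tau_sq X b \<omega> \<Longrightarrow> X t \<omega> < b * sqrt (1 - t)"
    and tau_le_iff: "\<And>t. 0 \<le> t \<Longrightarrow> t \<le> 1 \<Longrightarrow> tau_sq X b \<omega> \<le> t \<longleftrightarrow> (\<exists>s\<in>{0..t}. b * sqrt (1 - s) \<le> X s \<omega>)"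
proof -
  define H where "H = {t \<in> {0..1}. X t \<omega> \<ge> b * sqrt (1 - t)}"
  have \<tau>: "tau_sq X b \<omega> = Inf H" by (simp add: tau_sq_def H_def)
  have "continuous_on {0..1} (\<lambda>t. X t \<omega> - b * sqrt (1 - t))"
    by (intro continuous_intros continuous_paths[OF \<omega>])
  then have "closed ((\<lambda>t. X t \<omega> - b * sqrt (1 - t)) -` {0..} \<inter> {0..1})"
    by (intro continuous_on_closed_vimage[THEN iffD1, rule_format]) auto
  also have "(\<lambda>t. X t \<omega> - b * sqrt (1 - t)) -` {0..} \<inter> {0..1} = H" by (auto simp: H_def)
  finally have "closed H" .
  have "1 \<in> H" using ends_at_0[OF \<omega>] by (simp add: H_def)
  have bdd: "bdd_below H" by (auto simp: H_def)
  have "Inf H \<in> H" by (rule closed_contains_Inf) (use \<open>1 \<in> H\<close> bdd \<open>closed H\<close> in auto)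
  then show "0 \<le> tau_sq X b \<omega>" "tau_sq X b \<omega> \<le> 1"
    "b * sqrt (1 - tau_sq X b \<omega>) \<le> X (tau_sq X b \<omega>) \<omega>"
    unfolding \<tau> by (auto simp: H_def)
  have le: "tau_sq X b \<omega> \<le> t" if "0 \<le> t" "t \<le> 1" "b * sqrt (1 - t) \<le> X t \<omega>" for t
    unfolding \<tau> by (rule cInf_lower[OF _ bdd]) (use that in \<open>auto simp: H_def\<close>)
  show "X t \<omega> < b * sqrt (1 - t)" if "0 \<le> t" "t < tau_sq X b \<omega>" for t
    using le[of t] that \<open>tau_sq X b \<omega> \<le> 1\<close> by force
  show "tau_sq X b \<omega> \<le> t \<longleftrightarrow> (\<exists>s\<in>{0..t}. b * sqrt (1 - s) \<le> X s \<omega>)" if "0 \<le> t" "t \<le> 1" for t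
  proof
    assume "tau_sq X b \<omega> \<le> t"
    with \<open>Inf H \<in> H\<close> show "\<exists>s\<in>{0..t}. b * sqrt (1 - s) \<le> X s \<omega>"
      unfolding \<tau> by (auto simp: H_def)
  next
    assume "\<exists>s\<in>{0..t}. b * sqrt (1 - s) \<le> X s \<omega>"
    then show "tau_sq X b \<omega> \<le> t" using le that by force
  qed
qed

text \<open>With \<open>b \<ge> 0\<close> the path starts on or below the boundary, so continuity
  rules out an overshoot: some time up to \<open>tau_sq\<close> gives equality, and no earlier time
  can.\<close>

lemma tau_hit:
  assumes \<omega>: "\<omega> \<in> space M" and "0 \<le> b"
  shows "X (tau_sq X b \<omega>) \<omega> = b * sqrt (1 - tau_sq X b \<omega>)"
proof -
  let ?\<tau> = "tau_sq X b \<omega>"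
  let ?f = "\<lambda>t. X t \<omega> - b * sqrt (1 - t)"
  have "continuous_on {0..?\<tau>} ?f"
    by (intro continuous_intros continuous_on_subset[OF continuous_paths[OF \<omega>]])
      (use tau_le_1[OF \<omega>] in auto)
  moreover have "?f 0 \<le> 0" using starts_at_0[OF \<omega>] \<open>0 \<le> b\<close> by simp
  moreover have "0 \<le> ?f ?\<tau>" using tau_hit_ge[OF \<omega>, of b] by simp
  ultimately obtain x where x: "0 \<le> x" "x \<le> ?\<tau>" "?f x = 0"
    using IVT'[of ?f 0 0 ?\<tau>] tau_ge_0[OF \<omega>] by auto
  then have "x = ?\<tau>" using before_tau[OF \<omega>, of x b] by force
  then show ?thesis using x by simp
qed

lemma tau_pos: "\<omega> \<in> space M \<Longrightarrow> 0 < b \<Longrightarrow> 0 < tau_sq X b \<omega>"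
  using tau_hit[of \<omega> b] tau_ge_0[of \<omega> b] starts_at_0[of \<omega>] by (cases "tau_sq X b \<omega> = 0") auto

lemma tau_0: "\<omega> \<in> space M \<Longrightarrow> tau_sq X 0 \<omega> = 0"
  using tau_le_iff[of \<omega> 0 0] tau_ge_0[of \<omega> 0] starts_at_0[of \<omega>] by auto

text \<open>Reaching the boundary by time \<open>t\<close> is a condition over uncountably many
  times. By continuity it means that on a countable dense set \<open>D\<close> the distance below
  the boundary gets smaller than every \<open>1 / Suc n\<close>, a countable combination of events
  in \<open>F t\<close>.\<close>

lemma tau_stopping:
  assumes t: "0 \<le> t" "t < 1"
  shows "{\<omega> \<in> space M. tau_sq X b \<omega> \<le> t} \<in> sets (F t)"
proof -
  obtain D where D: "countable D" "D \<subseteq> {0..t}" "{0..t} \<subseteq> closure D"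
    by (rule separable)
  let ?f = "\<lambda>s \<omega>. X s \<omega> - b * sqrt (1 - s)"
  have iff: "tau_sq X b \<omega> \<le> t \<longleftrightarrow> (\<forall>n. \<exists>q\<in>D. - (1 / Suc n) < ?f q \<omega>)" if \<omega>: "\<omega> \<in> space M" for \<omega>
  proof -
    have cont: "continuous_on {0..t} (\<lambda>s. ?f s \<omega>)"
      by (intro continuous_intros continuous_on_subset[OF continuous_paths[OF \<omega>]]) (use t in auto)
    show ?thesis
    proof
      assume "tau_sq X b \<omega> \<le> t"
      then obtain s where s: "s \<in> {0..t}" "0 \<le> ?f s \<omega>" using tau_le_iff[OF \<omega>, of t b] t by auto
      show "\<forall>n. \<exists>q\<in>D. - (1 / Suc n) < ?f q \<omega>"
      proof
        fix n
        obtain \<delta> where \<delta>: "0 < \<delta>" "\<And>x. x \<in> {0..t} \<Longrightarrow> dist x s < \<delta> \<Longrightarrow> dist (?f x \<omega>) (?f s \<omega>) < 1 / Suc n"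
          using cont s(1) unfolding continuous_on_iff by (metis of_nat_0_less_iff zero_less_Suc zero_less_divide_1_iff)
        have "s \<in> closure D" using s D by blast
        then obtain q where q: "q \<in> D" "dist q s < \<delta>" using \<delta>(1) unfolding closure_approachable by blast
        then have "dist (?f q \<omega>) (?f s \<omega>) < 1 / Suc n" using \<delta>(2) D(2) by blast
        with s(2) have "- (1 / Suc n) < ?f q \<omega>" unfolding dist_real_def by linarith
        with q show "\<exists>q\<in>D. - (1 / Suc n) < ?f q \<omega>" by blast
      qed
    next
      assume *: "\<forall>n. \<exists>q\<in>D. - (1 / Suc n) < ?f q \<omega>"
      \<comment> \<open>The maximum over the compact interval turns the approximate inequalities on
        \<open>D\<close> into an exact one at \<open>s\<close>.\<close>
      obtain s where s: "s \<in> {0..t}" "\<And>y. y \<in> {0..t} \<Longrightarrow> ?f y \<omega> \<le> ?f s \<omega>"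
        using continuous_attains_sup[OF compact_Icc _ cont] t by force
      have "0 \<le> ?f s \<omega>"
      proof (rule ccontr)
        assume "\<not> 0 \<le> ?f s \<omega>"
        then obtain n where n: "1 / Suc n < - ?f s \<omega>"
          using nat_approx_posE[of "- ?f s \<omega>"] by auto
        obtain q where "q \<in> D" "- (1 / Suc n) < ?f q \<omega>" using * by blast
        with s(2)[of q] D(2) n show False by force
      qed
      with s(1) show "tau_sq X b \<omega> \<le> t" using tau_le_iff[OF \<omega>, of t b] t by auto
    qed
  qed
  have meas: "{\<omega> \<in> space M. - (1 / Suc n) < ?f q \<omega>} \<in> sets (F t)" if "q \<in> D" for q n
  proof -
    have q: "q \<in> {0..1}" "q \<le> t" using that D(2) t by auto
    have "{\<omega> \<in> space (F q). - (1 / Suc n) < ?f q \<omega>} \<in> sets (F q)"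
      using adapted[OF q(1)] by measurable
    then show ?thesis using sets_F_mono[OF q(2)] by (auto simp: space_F)
  qed
  have "{\<omega> \<in> space M. tau_sq X b \<omega> \<le> t} = {\<omega> \<in> space M. \<forall>n. \<exists>q\<in>D. - (1 / Suc n) < ?f q \<omega>}"
    using iff by blast
  also have "\<dots> = (\<Inter>n. \<Union>q\<in>D. {\<omega> \<in> space M. - (1 / Suc n) < ?f q \<omega>})" by auto
  also have "\<dots> \<in> sets (F t)"
    using D(1) meas by (intro sets.countable_INT sets.countable_UN') auto
  finally show ?thesis .
qed

lemma tau_measurable: "tau_sq X b \<in> borel_measurable M"
proof (rule borel_measurableI_le)
  fix t :: real
  consider "t < 0" | "0 \<le> t" "t < 1" | "1 \<le> t" by linarith
  then show "{\<omega> \<in> space M. tau_sq X b \<omega> \<le> t} \<in> sets M"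
  proof cases
    case 1
    then have "{\<omega> \<in> space M. tau_sq X b \<omega> \<le> t} = {}" using tau_ge_0[of _ b] by (force simp: not_le)
    then show ?thesis by (metis sets.empty_sets)
  next
    case 2
    then show ?thesis using tau_stopping[of t b] sets_F_subset[of t] by auto
  next
    case 3
    then have "{\<omega> \<in> space M. tau_sq X b \<omega> \<le> t} = space M" using tau_le_1[of _ b] by (force intro: order_trans)
    then show ?thesis by simp
  qed
qed

end

lemma sigma_eq_tau: "sigma_sq X d = tau_sq (\<lambda>t \<omega>. - X t \<omega>) d"
  unfolding sigma_sq_def tau_sq_def by (intro ext arg_cong[where f=Inf]) auto

lemma tau_eq_sigma: "tau_sq X d = sigma_sq (\<lambda>t \<omega>. - X t \<omega>) d"
  by (simp add: sigma_eq_tau)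

section \<open>Payoffs and equilibria\<close>

lemma ext_expectation_real:
  assumes "integrable M g" "\<And>\<omega>. \<omega> \<in> space M \<Longrightarrow> Y \<omega> = ereal (g \<omega>)"
  shows "ext_expectation M Y = ereal (\<integral>\<omega>. g \<omega> \<partial>M)"
proof -
  have "(\<integral>\<^sup>+\<omega>. e2ennreal (Y \<omega>) \<partial>M) = (\<integral>\<^sup>+\<omega>. ennreal (g \<omega>) \<partial>M)"
    "(\<integral>\<^sup>+\<omega>. e2ennreal (- Y \<omega>) \<partial>M) = (\<integral>\<^sup>+\<omega>. ennreal (- g \<omega>) \<partial>M)"
    using assms(2) by (auto intro!: nn_integral_cong)
  moreover obtain r q where "0 \<le> r" "0 \<le> q" "(\<integral>\<^sup>+\<omega>. ennreal (g \<omega>) \<partial>M) = ennreal r"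
    "(\<integral>\<^sup>+\<omega>. ennreal (- g \<omega>) \<partial>M) = ennreal q" "(\<integral>\<omega>. g \<omega> \<partial>M) = r - q"
    using assms(1) by (rule integrableE)
  ultimately show ?thesis by (simp add: ext_expectation_def enn2ereal_ennreal)
qed

lemma R2_eq_R1: "R2 M X \<alpha> \<theta> \<tau> \<sigma> = R1 M (\<lambda>t \<omega>. - X t \<omega>) \<alpha> \<theta> \<sigma> \<tau>"
proof -
  have eq: "scaled_payoff (profile_G2 \<alpha>) t x = scaled_payoff (profile_G1 \<alpha>) t (- x)"
    "scaled_payoff (profile_L2 \<theta>) t x = scaled_payoff (profile_L1 \<theta>) t (- x)" for t x
    by (auto simp: scaled_payoff_def profile_G1_def profile_G2_def profile_L1_def profile_L2_def
        divide_le_0_iff zero_le_divide_iff)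
  show ?thesis unfolding R1_def R2_def eq ..
qed

context brownian_bridge
begin

interpretation neg: brownian_bridge M F "\<lambda>t \<omega>. - X t \<omega>" by (rule uminus_bridge)

lemmas sigma_ge_0 = neg.tau_ge_0[folded sigma_eq_tau]
  and sigma_le_1 = neg.tau_le_1[folded sigma_eq_tau]
  and before_sigma = neg.before_tau[folded sigma_eq_tau]
  and sigma_hit = neg.tau_hit[folded sigma_eq_tau]
  and sigma_pos = neg.tau_pos[folded sigma_eq_tau]
  and sigma_0 = neg.tau_0[folded sigma_eq_tau]
  and sigma_stopping = neg.tau_stopping[folded sigma_eq_tau]
  and sigma_measurable = neg.tau_measurable[folded sigma_eq_tau]

section \<open>Exit from the region between the two boundaries\<close>

context
  fixes b d :: real
  assumes b: "0 < b" and d: "0 < d"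
begin

abbreviation "\<tau> \<equiv> tau_sq X b"
abbreviation "\<sigma> \<equiv> sigma_sq X d"

text \<open>Before time 1 the boundaries are \<open>(b + d) * sqrt (1 - t) > 0\<close> apart, so the
  path cannot be on both. Ties occur only at time 1, where all payoffs are 0.\<close>

lemma tau_eq_sigma_imp: assumes \<omega>: "\<omega> \<in> space M" and "\<tau> \<omega> = \<sigma> \<omega>" shows "\<tau> \<omega> = 1"
proof (rule ccontr)
  assume "\<tau> \<omega> \<noteq> 1"
  then have "0 < sqrt (1 - \<tau> \<omega>)" using tau_le_1[OF \<omega>, of b] by simp
  then have "0 < (b + d) * sqrt (1 - \<tau> \<omega>)" using b d by simp
  moreover have "(b + d) * sqrt (1 - \<tau> \<omega>) = X (\<tau> \<omega>) \<omega> + - X (\<sigma> \<omega>) \<omega>"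
    using tau_hit[OF \<omega>, of b] sigma_hit[OF \<omega>, of d] b d assms(2) by (simp add: distrib_right)
  ultimately show False unfolding assms(2) by linarith
qed

definition "hit_up = expectation (\<lambda>\<omega>. if \<tau> \<omega> < \<sigma> \<omega> then sqrt (1 - \<tau> \<omega>) else 0)"
definition "hit_down = expectation (\<lambda>\<omega>. if \<sigma> \<omega> < \<tau> \<omega> then sqrt (1 - \<sigma> \<omega>) else 0)"

lemma hit_integrable:
  "integrable M (\<lambda>\<omega>. if \<tau> \<omega> < \<sigma> \<omega> then sqrt (1 - \<tau> \<omega>) else 0)"
  "integrable M (\<lambda>\<omega>. if \<sigma> \<omega> < \<tau> \<omega> then sqrt (1 - \<sigma> \<omega>) else 0)"
proof -
  note [measurable] = tau_measurable[of b] sigma_measurable[of d]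
  show "integrable M (\<lambda>\<omega>. if \<tau> \<omega> < \<sigma> \<omega> then sqrt (1 - \<tau> \<omega>) else 0)"
    "integrable M (\<lambda>\<omega>. if \<sigma> \<omega> < \<tau> \<omega> then sqrt (1 - \<sigma> \<omega>) else 0)"
    using tau_ge_0[of _ b] tau_le_1[of _ b] sigma_ge_0[of _ d] sigma_le_1[of _ d]
    by (intro integrable_const_bound[where B=1]; force intro!: AE_I2)+
qed

text \<open>At the first exit \<open>X / sqrt (1 - t)\<close> is either \<open>b\<close> or
  \<open>- d\<close>, so \<open>mills\<close> takes constant values there and the expectation is
  linear in \<open>hit_up\<close> and \<open>hit_down\<close>. The two signs give two
  equations.\<close>

lemma hit_equation:
  assumes sg: "sg \<in> {1, -1}"
  shows "mills (sg * b) * hit_up + mills (- sg * d) * hit_down = gauss_half"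
proof -
  define \<rho> where "\<rho> \<omega> = min (\<tau> \<omega>) (\<sigma> \<omega>)" for \<omega>
  have \<rho>: "0 \<le> \<rho> \<omega> \<and> \<rho> \<omega> \<le> 1" if "\<omega> \<in> space M" for \<omega>
    using tau_ge_0[OF that, of b] tau_le_1[OF that, of b] sigma_ge_0[OF that, of d] by (auto simp: \<rho>_def)
  have stop: "{\<omega> \<in> space M. \<rho> \<omega> \<le> t} \<in> sets (F t)" if "0 \<le> t" "t < 1" for t
  proof -
    have "{\<omega> \<in> space M. \<rho> \<omega> \<le> t} = {\<omega> \<in> space M. \<tau> \<omega> \<le> t} \<union> {\<omega> \<in> space M. \<sigma> \<omega> \<le> t}"
      by (auto simp: \<rho>_def min_le_iff_disj)
    then show ?thesis using tau_stopping[OF that] sigma_stopping[OF that] by auto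
  qed
  have bound: "\<bar>X t \<omega>\<bar> \<le> max b d * sqrt (1 - t)"
    if \<omega>: "\<omega> \<in> space M" and t: "0 \<le> t" "t < 1" "t \<le> \<rho> \<omega>" for \<omega> t
  proof -
    have "X t \<omega> \<le> b * sqrt (1 - t)"
      using before_tau[OF \<omega> t(1), of b] tau_hit[OF \<omega>, of b] b t(3) by (cases "t = \<tau> \<omega>") (auto simp: \<rho>_def)
    moreover have "- X t \<omega> \<le> d * sqrt (1 - t)"
      using before_sigma[OF \<omega> t(1), of d] sigma_hit[OF \<omega>, of d] d t(3) by (cases "t = \<sigma> \<omega>") (auto simp: \<rho>_def)
    moreover have "b * sqrt (1 - t) \<le> max b d * sqrt (1 - t)" "d * sqrt (1 - t) \<le> max b d * sqrt (1 - t)"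
      using t by (auto intro!: mult_right_mono)
    ultimately show ?thesis by linarith
  qed
  have eq: "(if \<rho> \<omega> < 1 then sqrt (1 - \<rho> \<omega>) * mills (sg * X (\<rho> \<omega>) \<omega> / sqrt (1 - \<rho> \<omega>)) else 0)
      = mills (sg * b) * (if \<tau> \<omega> < \<sigma> \<omega> then sqrt (1 - \<tau> \<omega>) else 0)
        + mills (- sg * d) * (if \<sigma> \<omega> < \<tau> \<omega> then sqrt (1 - \<sigma> \<omega>) else 0)" if \<omega>: "\<omega> \<in> space M" for \<omega>
  proof (cases "\<tau> \<omega>" "\<sigma> \<omega>" rule: linorder_cases)
    case less
    then have "\<tau> \<omega> < 1" using sigma_le_1[OF \<omega>, of d] by simp
    with less tau_hit[OF \<omega>, of b] b show ?thesis by (simp add: \<rho>_def)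
  next
    case equal
    then have "\<rho> \<omega> = 1" using tau_eq_sigma_imp[OF \<omega>] by (simp add: \<rho>_def)
    with equal show ?thesis by simp
  next
    case greater
    then have "\<sigma> \<omega> < 1" using tau_le_1[OF \<omega>, of b] by simp
    moreover have "X (\<sigma> \<omega>) \<omega> = - d * sqrt (1 - \<sigma> \<omega>)" using sigma_hit[OF \<omega>, of d] d by simp
    ultimately show ?thesis using greater by (simp add: \<rho>_def)
  qed
  have "gauss_half = expectation (\<lambda>\<omega>. mills (sg * b) * (if \<tau> \<omega> < \<sigma> \<omega> then sqrt (1 - \<tau> \<omega>) else 0)
        + mills (- sg * d) * (if \<sigma> \<omega> < \<tau> \<omega> then sqrt (1 - \<sigma> \<omega>) else 0))"
    by (subst integral_mills_stopped[OF \<rho> stop bound sg, symmetric])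
      (auto intro!: Bochner_Integration.integral_cong simp only: eq)
  also have "\<dots> = mills (sg * b) * hit_up + mills (- sg * d) * hit_down"
    unfolding hit_up_def hit_down_def using hit_integrable by simp
  finally show ?thesis by simp
qed

text \<open>In the rescaled unknowns \<open>P\<close> and \<open>Q\<close> the sum of the two
  equations gives \<open>P + Q = 1\<close>, their difference
  \<open>gauss_int b * P = gauss_int d * Q\<close>.\<close>

lemma hit_values:
  "hit_up = exp (- b\<^sup>2 / 2) * gauss_int d / (gauss_int b + gauss_int d)"
  "hit_down = exp (- d\<^sup>2 / 2) * gauss_int b / (gauss_int b + gauss_int d)"
proof -
  define P where "P = exp (b\<^sup>2 / 2) * hit_up"
  define Q where "Q = exp (d\<^sup>2 / 2) * hit_down"
  have c: "0 < gauss_half" using gauss_int_less_half[of 0] by simp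
  have pos: "0 < gauss_int b" "0 < gauss_int d" using b d gauss_int_pos by auto
  have 1: "(gauss_half + gauss_int b) * P + (gauss_half - gauss_int d) * Q = gauss_half"
    using hit_equation[of 1] by (simp add: mills_def gauss_int_minus P_def Q_def mult_ac)
  have 2: "(gauss_half - gauss_int b) * P + (gauss_half + gauss_int d) * Q = gauss_half"
    using hit_equation[of "-1"] by (simp add: mills_def gauss_int_minus P_def Q_def mult_ac)
  have "gauss_half * (P + Q) = gauss_half * 1" using 1 2 by (simp add: algebra_simps)
  then have PQ: "P + Q = 1" using c by simp
  have "gauss_int b * P = gauss_int d * Q" using 1 2 by (simp add: algebra_simps)
  with PQ have "(gauss_int b + gauss_int d) * P = gauss_int d" "(gauss_int b + gauss_int d) * Q = gauss_int b"
    by algebra+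
  then have "P = gauss_int d / (gauss_int b + gauss_int d)" "Q = gauss_int b / (gauss_int b + gauss_int d)"
    using pos by (simp_all add: eq_divide_eq mult.commute)
  moreover have "hit_up = exp (- b\<^sup>2 / 2) * P" "hit_down = exp (- d\<^sup>2 / 2) * Q"
    by (simp_all add: P_def Q_def flip: mult.assoc exp_add)
  ultimately show "hit_up = exp (- b\<^sup>2 / 2) * gauss_int d / (gauss_int b + gauss_int d)"
    "hit_down = exp (- d\<^sup>2 / 2) * gauss_int b / (gauss_int b + gauss_int d)" by simp_all
qed

text \<open>A threshold \<open>b > 0\<close> is hit at a positive level whenever time 1 has not
  come, so the value \<open>- \<infinity>\<close> is never collected and the extended expectation is
  an ordinary one.\<close>

lemma R1_positive_thresholds: "R1 M X \<alpha> \<theta> \<tau> \<sigma> = ereal ((b - \<alpha>) * hit_up - \<theta> * d * hit_down)"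
proof -
  let ?g = "\<lambda>\<omega>. (b - \<alpha>) * (if \<tau> \<omega> < \<sigma> \<omega> then sqrt (1 - \<tau> \<omega>) else 0)
      - \<theta> * d * (if \<sigma> \<omega> < \<tau> \<omega> then sqrt (1 - \<sigma> \<omega>) else 0)"
  have "R1 M X \<alpha> \<theta> \<tau> \<sigma> = ereal (expectation ?g)"
    unfolding R1_def
  proof (rule ext_expectation_real)
    show "integrable M ?g" using hit_integrable by simp
    fix \<omega> assume \<omega>: "\<omega> \<in> space M"
    show "(if \<tau> \<omega> \<le> \<sigma> \<omega> then scaled_payoff (profile_G1 \<alpha>) (\<tau> \<omega>) (X (\<tau> \<omega>) \<omega>)
        else scaled_payoff (profile_L1 \<theta>) (\<sigma> \<omega>) (X (\<sigma> \<omega>) \<omega>)) = ereal (?g \<omega>)"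
    proof (cases "\<tau> \<omega>" "\<sigma> \<omega>" rule: linorder_cases)
      case less
      then have "\<tau> \<omega> < 1" using sigma_le_1[OF \<omega>, of d] by simp
      with less tau_hit[OF \<omega>, of b] b show ?thesis
        by (simp add: scaled_payoff_def profile_G1_def mult.commute)
    next
      case equal
      then show ?thesis using tau_eq_sigma_imp[OF \<omega>] by (simp add: scaled_payoff_def)
    next
      case greater
      then have "\<sigma> \<omega> < 1" using tau_le_1[OF \<omega>, of b] by simp
      moreover have "X (\<sigma> \<omega>) \<omega> = - d * sqrt (1 - \<sigma> \<omega>)" using sigma_hit[OF \<omega>, of d] d by simp
      ultimately show ?thesis using greater
        by (simp add: scaled_payoff_def profile_L1_def mult_ac)
    qed
  qed
  then show ?thesis using hit_integrable by (simp add: hit_up_def hit_down_def)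
qed

end

lemma R1_tau_0: assumes "0 \<le> d" shows "R1 M X \<alpha> \<theta> (tau_sq X 0) (sigma_sq X d) = ereal (- \<alpha>)"
proof -
  have "R1 M X \<alpha> \<theta> (tau_sq X 0) (sigma_sq X d) = ereal (expectation (\<lambda>_. - \<alpha>))"
    unfolding R1_def
    by (rule ext_expectation_real)
      (auto simp: tau_0 sigma_ge_0 starts_at_0 scaled_payoff_def profile_G1_def)
  then show ?thesis by (simp add: prob_space)
qed

lemma R1_sigma_0: assumes "0 < b" shows "R1 M X \<alpha> \<theta> (tau_sq X b) (sigma_sq X 0) = 0"
proof -
  have "R1 M X \<alpha> \<theta> (tau_sq X b) (sigma_sq X 0) = ereal (expectation (\<lambda>_. 0))"
    unfolding R1_def
  proof (rule ext_expectation_real)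
    fix \<omega> assume \<omega>: "\<omega> \<in> space M"
    show "(if tau_sq X b \<omega> \<le> sigma_sq X 0 \<omega> then scaled_payoff (profile_G1 \<alpha>) (tau_sq X b \<omega>) (X (tau_sq X b \<omega>) \<omega>)
        else scaled_payoff (profile_L1 \<theta>) (sigma_sq X 0 \<omega>) (X (sigma_sq X 0 \<omega>) \<omega>)) = ereal 0"
      using tau_pos[OF \<omega> assms] sigma_0[OF \<omega>] starts_at_0[OF \<omega>]
      by (simp add: scaled_payoff_def profile_L1_def flip: zero_ereal_def)
  qed simp
  then show ?thesis by simp
qed

text \<open>The loss carries the weight \<open>gauss_int b / (gauss_int b + gauss_int d)\<close>,
  which is 1 minus the same fraction with \<open>gauss_int d\<close> on top. The 1 gives the term
  free of \<open>b\<close>, the rest joins the gain in \<open>response\<close>. At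
  \<open>b = 0\<close> both sides are \<open>- \<alpha>\<close>.\<close>

lemma R1_value:
  assumes "0 \<le> b" "0 < d"
  shows "R1 M X \<alpha> \<theta> (tau_sq X b) (sigma_sq X d)
    = ereal (gauss_int d * response \<alpha> \<theta> d b - \<theta> * d * exp (- d\<^sup>2 / 2))"
proof (cases "b = 0")
  case True
  then show ?thesis
    using R1_tau_0[of d \<alpha> \<theta>] gauss_int_pos[OF assms(2)] assms by (simp add: response_def)
next
  case False
  then have b: "0 < b" using assms by simp
  define s where "s = gauss_int b + gauss_int d"
  have s: "s \<noteq> 0" using gauss_int_pos[OF b] gauss_int_pos[OF assms(2)] by (simp add: s_def)
  have d: "gauss_int d = s - gauss_int b" by (simp add: s_def)
  have "(b - \<alpha>) * (u * gauss_int d / s) - \<theta> * d * (v * gauss_int b / s)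
      = gauss_int d * (((b - \<alpha>) * u + \<theta> * d * v) / s) - \<theta> * d * v" for u v
    unfolding d using s by (simp add: field_simps)
  then show ?thesis
    unfolding R1_positive_thresholds[OF b assms(2)] hit_values[OF b assms(2)] response_def s_def by simp
qed

lemma best_response_iff:
  assumes "0 < d"
  shows "R1 M X \<alpha> \<theta> (tau_sq X d) (sigma_sq X d) = (SUP \<tau>\<in>strategies1 X. R1 M X \<alpha> \<theta> \<tau> (sigma_sq X d))
    \<longleftrightarrow> (\<forall>b\<ge>0. response \<alpha> \<theta> d b \<le> response \<alpha> \<theta> d d)"
proof -
  have "R1 M X \<alpha> \<theta> (tau_sq X d) (sigma_sq X d) = (SUP \<tau>\<in>strategies1 X. R1 M X \<alpha> \<theta> \<tau> (sigma_sq X d))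
    \<longleftrightarrow> (\<forall>\<tau>\<in>strategies1 X. R1 M X \<alpha> \<theta> \<tau> (sigma_sq X d) \<le> R1 M X \<alpha> \<theta> (tau_sq X d) (sigma_sq X d))"
    (is "?l = _ \<longleftrightarrow> ?r")
  proof
    assume "?l = (SUP \<tau>\<in>strategies1 X. R1 M X \<alpha> \<theta> \<tau> (sigma_sq X d))"
    then show ?r by (metis SUP_upper)
  next
    assume ?r
    moreover have "tau_sq X d \<in> strategies1 X" using assms by (auto simp: strategies1_def)
    ultimately show "?l = (SUP \<tau>\<in>strategies1 X. R1 M X \<alpha> \<theta> \<tau> (sigma_sq X d))"
      by (intro antisym SUP_upper SUP_least) auto
  qed
  also have "?r \<longleftrightarrow> (\<forall>b\<ge>0. R1 M X \<alpha> \<theta> (tau_sq X b) (sigma_sq X d) \<le> R1 M X \<alpha> \<theta> (tau_sq X d) (sigma_sq X d))"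
    by (auto simp: strategies1_def)
  also have "\<dots> \<longleftrightarrow> (\<forall>b\<ge>0. response \<alpha> \<theta> d b \<le> response \<alpha> \<theta> d d)"
    using assms gauss_int_pos[OF assms] by (simp add: R1_value)
  finally show ?thesis .
qed

end

section \<open>From best responses to equilibria\<close>

lemma strategies2_eq: "strategies2 X = strategies1 (\<lambda>t \<omega>. - X t \<omega>)"
  by (auto simp: strategies1_def strategies2_def sigma_eq_tau)

context brownian_bridge
begin

interpretation neg: brownian_bridge M F "\<lambda>t \<omega>. - X t \<omega>" by (rule uminus_bridge)

lemma nash_equilibrium_iff:
  assumes "0 < d"
  shows "nash_equilibrium M X \<alpha> \<theta> (tau_sq X d) (sigma_sq X d)
    \<longleftrightarrow> (\<forall>b\<ge>0. response \<alpha> \<theta> d b \<le> response \<alpha> \<theta> d d)"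
proof -
  have "tau_sq X d \<in> strategies1 X" "sigma_sq X d \<in> strategies2 X"
    using assms by (auto simp: strategies1_def strategies2_def)
  then show ?thesis
    using best_response_iff[OF assms] neg.best_response_iff[OF assms]
    by (simp add: nash_equilibrium_def R2_eq_R1 strategies2_eq sigma_eq_tau[of X] flip: tau_eq_sigma)
qed

text \<open>Against an opponent who stops at time 0 any positive threshold, here 1, earns 0, whereas
  stopping at once earns \<open>- \<alpha>\<close>.\<close>

lemma not_nash_equilibrium_0:
  assumes "0 < \<alpha>"
  shows "\<not> nash_equilibrium M X \<alpha> \<theta> (tau_sq X 0) (sigma_sq X 0)"
proof
  assume "nash_equilibrium M X \<alpha> \<theta> (tau_sq X 0) (sigma_sq X 0)"
  moreover have "tau_sq X 1 \<in> strategies1 X" by (auto simp: strategies1_def intro!: exI[of _ 1])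
  ultimately have "R1 M X \<alpha> \<theta> (tau_sq X 1) (sigma_sq X 0) \<le> R1 M X \<alpha> \<theta> (tau_sq X 0) (sigma_sq X 0)"
    unfolding nash_equilibrium_def by (metis SUP_upper)
  then show False using assms by (simp add: R1_sigma_0 R1_tau_0)
qed

lemma mem_symmetric_equilibria_iff:
  assumes "0 < \<alpha>"
  shows "d \<in> symmetric_equilibria M X \<alpha> \<theta> \<longleftrightarrow> 0 < d \<and> (\<forall>b\<ge>0. response \<alpha> \<theta> d b \<le> response \<alpha> \<theta> d d)"
  using nash_equilibrium_iff[of d] not_nash_equilibrium_0[OF assms]
  by (cases "d = 0") (auto simp: symmetric_equilibria_def)

lemma symmetric_equilibriaD:
  assumes "0 < \<alpha>" "d \<in> symmetric_equilibria M X \<alpha> \<theta>"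
  shows "0 < d" "foc \<alpha> \<theta> d = 0" "\<alpha> / 2 < d"
  using assms mem_symmetric_equilibria_iff[of \<alpha> d] best_response_imp_foc[of \<alpha> d \<theta>] by auto

lemma symmetric_equilibriaI:
  assumes "0 < \<alpha>" "\<alpha> / 2 < d" "foc \<alpha> \<theta> d = 0" "0 \<le> d - \<alpha> - \<theta> * d + 2 * \<alpha> * exp (d\<^sup>2 / 2)"
  shows "d \<in> symmetric_equilibria M X \<alpha> \<theta>"
proof -
  have "0 < d" using assms by linarith
  with assms show ?thesis using foc_imp_best_response[of \<alpha> d \<theta>] by (auto simp: mem_symmetric_equilibria_iff)
qed

end

theorem theorem2p13:
  fixes M :: "'a measure" and F :: "real \<Rightarrow> 'a measure" and X :: "real \<Rightarrow> 'a \<Rightarrow> real"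
  assumes "brownian_bridge M F X"
  shows "(\<forall>\<alpha>>0. \<forall>\<theta>>0.
      (finite (symmetric_equilibria M X \<alpha> \<theta>) \<and> card (symmetric_equilibria M X \<alpha> \<theta>) \<le> 3) \<and>
      (\<theta> \<ge> 1 + max (2 * \<alpha> * (\<alpha> + (\<alpha>\<^sup>2 + 1) * psi \<alpha>)) (1 / \<alpha> * (4 + \<alpha>\<^sup>2) * psi (\<alpha> / 2)) \<longrightarrow>
        symmetric_equilibria M X \<alpha> \<theta> = {}) \<and>
      (\<theta> \<le> 1 \<longrightarrow> (\<exists>!b. b \<in> symmetric_equilibria M X \<alpha> \<theta>))) \<and>
    (\<exists>\<alpha>>0. \<exists>\<theta>>0. \<exists>b c. b \<noteq> c \<and>
      b \<in> symmetric_equilibria M X \<alpha> \<theta> \<and> c \<in> symmetric_equilibria M X \<alpha> \<theta>)"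
proof -
  interpret brownian_bridge M F X by fact
  have at_most_3: "finite (symmetric_equilibria M X \<alpha> \<theta>) \<and> card (symmetric_equilibria M X \<alpha> \<theta>) \<le> 3"
    if "0 < \<alpha>" for \<alpha> \<theta>
  proof (rule finite_card_le_3)
    fix x1 x2 x3 x4
    assume x: "x1 \<in> symmetric_equilibria M X \<alpha> \<theta>" "x2 \<in> symmetric_equilibria M X \<alpha> \<theta>"
      "x3 \<in> symmetric_equilibria M X \<alpha> \<theta>" "x4 \<in> symmetric_equilibria M X \<alpha> \<theta>"
      "x1 < x2" "x2 < x3" "x3 < x4"
    show False
      by (rule foc_zeros[OF less_imp_le[OF symmetric_equilibriaD(1)[OF that x(1)]] x(5-7)
            x(1-4)[THEN symmetric_equilibriaD(2)[OF that]]])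
  qed
  have none: "symmetric_equilibria M X \<alpha> \<theta> = {}"
    if "0 < \<alpha>" "\<theta> \<ge> 1 + max (2 * \<alpha> * (\<alpha> + (\<alpha>\<^sup>2 + 1) * psi \<alpha>)) (1 / \<alpha> * (4 + \<alpha>\<^sup>2) * psi (\<alpha> / 2))" for \<alpha> \<theta>
  proof -
    have "foc \<alpha> \<theta> d < 0" if "\<alpha> / 2 < d" for d
      using foc_neg[of \<alpha> \<theta> d] \<open>0 < \<alpha>\<close> that \<open>\<theta> \<ge> _\<close> by linarith
    then show ?thesis using symmetric_equilibriaD[OF \<open>0 < \<alpha>\<close>] by force
  qed
  have unique: "\<exists>!b. b \<in> symmetric_equilibria M X \<alpha> \<theta>" if pos: "0 < \<alpha>" "0 < \<theta>" "\<theta> \<le> 1" for \<alpha> \<theta>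
  proof -
    obtain d where d: "\<alpha> < d" "\<And>x. 0 \<le> x \<Longrightarrow> foc \<alpha> \<theta> x = 0 \<longleftrightarrow> x = d"
      by (rule foc_unique_zero[OF pos]) blast
    \<comment> \<open>For \<theta> \<le> 1 the comparison with stopping at once holds automatically,
      because the exponential is at least 1.\<close>
    have "0 \<le> d - \<theta> * d" using that d(1) by (simp add: mult_left_le_one_le)
    moreover have "\<alpha> * 1 \<le> \<alpha> * exp (d\<^sup>2 / 2)" using that by (intro mult_left_mono) auto
    ultimately have "0 \<le> d - \<alpha> - \<theta> * d + 2 * \<alpha> * exp (d\<^sup>2 / 2)" using that(1) by linarith
    then have "d \<in> symmetric_equilibria M X \<alpha> \<theta>"
      using d that by (intro symmetric_equilibriaI) auto
    moreover have "x = d" if "x \<in> symmetric_equilibria M X \<alpha> \<theta>" for x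
      using symmetric_equilibriaD(1,2)[OF \<open>0 < \<alpha>\<close> that] d(2) by force
    ultimately show ?thesis by blast
  qed
  have many: "\<exists>\<alpha>>0. \<exists>\<theta>>0. \<exists>b c. b \<noteq> c \<and>
      b \<in> symmetric_equilibria M X \<alpha> \<theta> \<and> c \<in> symmetric_equilibria M X \<alpha> \<theta>"
  proof -
    obtain d where d: "63 / 8 < d" "d < 8" "foc 8 (psi 8 / 4) d = 0" "foc 8 (psi 8 / 4) 8 = 0" "0 < psi 8 / 4"
      "\<And>x. 63 / 8 \<le> x \<Longrightarrow> x \<le> 8 \<Longrightarrow> 0 \<le> x - 8 - psi 8 / 4 * x + 2 * 8 * exp (x\<^sup>2 / 2)"
      by (rule two_solutions) blast
    have "d \<in> symmetric_equilibria M X 8 (psi 8 / 4)" "8 \<in> symmetric_equilibria M X 8 (psi 8 / 4)"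
      using d(1-4) d(6)[of d] d(6)[of 8] by (auto intro!: symmetric_equilibriaI)
    moreover have "d \<noteq> 8" using d by simp
    moreover have "(0::real) < 8" by simp
    ultimately show ?thesis using d(5) by blast
  qed
  show ?thesis using at_most_3 none unique many by blast
qed

end
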